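(* Let $B,M\in\mathbb{R}^{d\times d}$ be symmetric positive definite matrices, let $1\le p\le d$, and let $\mathrm{St}_B(p,d)=\{X\in\mathbb{R}^{d\times p}: X^{T}BX=I_p\}$ be equipped with the Riemannian metric $g_X(\xi_X,\eta_X)=\mathrm{Tr}(\xi_X^{T}M\eta_X)$ inherited from $\mathbb{R}^{d\times p}$ with the (constant) metric $\mathrm{Tr}(U^{T}MV)$. Let $f:\mathrm{St}_B(p,d)\to\mathbb{R}$ be smooth and let $\bar f:\mathbb{R}^{d\times p}\to\mathbb{R}$ be a smooth extension of $f$. Then for every $X\in\mathrm{St}_B(p,d)$ and $\eta_X\in T_X\mathrm{St}_B(p,d)$, the Riemannian Hessian of $f$ is given in ambient coordinates by $$\mathrm{Hess} f(X)[\eta_X]=\Pi_X\left(M^{-1}\nabla^{2}\bar f(X)\eta_X-M^{-1}B\eta_X\left(X^{T}\nabla\bar f(X)-X^{T}M\,\mathrm{grad} f(X)\right)\right).$$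
   Context: $\mathrm{St}_B(p,d)$ is an embedded submanifold of $\mathbb{R}^{d\times p}$ with tangent space $T_X\mathrm{St}_B(p,d)=\{Z\in\mathbb{R}^{d\times p}: Z^{T}BX+X^{T}BZ=0\}$. $\Pi_X$ denotes the orthogonal projection of $\mathbb{R}^{d\times p}$ onto $T_X\mathrm{St}_B(p,d)$ with respect to the inner product $\mathrm{Tr}(U^{T}MV)$. $\nabla\bar f(X)\in\mathbb{R}^{d\times p}$ is the Euclidean gradient of $\bar f$ (with respect to the standard inner product $\mathrm{Tr}(U^{T}V)$), and $\nabla^{2}\bar f(X)\eta_X\in\mathbb{R}^{d\times p}$ is the Euclidean Hessian of $\bar f$ at $X$ applied to $\eta_X$, i.e. the directional derivative of $\nabla\bar f$ at $X$ along $\eta_X$. $\mathrm{grad} f(X)\in T_X\mathrm{St}_B(p,d)$ is the Riemannian gradient of $f$ with respect to $g$. The Riemannian Hessian is $\mathrm{Hess} f(X)[\eta_X]=\nabla_{\eta_X}\mathrm{grad} f$, where in this formula $\nabla$ is the Levi-Civita connection of $(\mathrm{St}_B(p,d),g)$. *)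

theory Defs
  imports "HOL-Analysis.Analysis"
begin

section \<open>Smooth functions\<close>

primrec cont_diff :: "nat \<Rightarrow> 'a::euclidean_space set \<Rightarrow> ('a \<Rightarrow> 'b::real_normed_vector) \<Rightarrow> bool" where
  "cont_diff 0 U f \<longleftrightarrow> continuous_on U f"
| "cont_diff (Suc k) U f \<longleftrightarrow>
     (\<forall>x\<in>U. f differentiable (at x)) \<and>
     (\<forall>v. cont_diff k U (\<lambda>x. frechet_derivative f (at x) v))"

text \<open>Class \<open>C\<^sup>\<infinity>\<close> on an open set.\<close>

definition smooth_open :: "'a::euclidean_space set \<Rightarrow> ('a \<Rightarrow> 'b::real_normed_vector) \<Rightarrow> bool" where
  "smooth_open U f \<longleftrightarrow> (\<forall>k. cont_diff k U f)"

text \<open>Smoothness of a function on an embedded submanifold \<open>S\<close>, in terms of local smooth extensions.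
  Functions and vector fields on \<open>S\<close> are represented by total functions whose values off \<open>S\<close>
  are irrelevant.\<close>

definition smooth_sub :: "'a::euclidean_space set \<Rightarrow> ('a \<Rightarrow> 'b::real_normed_vector) \<Rightarrow> bool" where
  "smooth_sub S f \<longleftrightarrow>
     (\<forall>x\<in>S. \<exists>U h. open U \<and> x \<in> U \<and> smooth_open U h \<and> (\<forall>y\<in>S \<inter> U. h y = f y))"

section \<open>Riemannian geometry of embedded submanifolds\<close>

text \<open>Below, \<open>S\<close> is the submanifold, \<open>T x\<close> its tangent space at \<open>x\<close>, as a subspace of the ambient
  space, and \<open>g x\<close> the metric on \<open>T x\<close>.

  The differential of a function on \<open>S\<close> is its Frechet derivative within \<open>S\<close>. That derivative
  depends only on the values on \<open>S\<close>. As a linear map on the ambient space it need not be unique, but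
  its values on tangent vectors are, so it must only be applied to tangent vectors.\<close>

definition differential ::
    "'a::euclidean_space set \<Rightarrow> ('a \<Rightarrow> 'b::real_normed_vector) \<Rightarrow> 'a \<Rightarrow> 'a \<Rightarrow> 'b" where
  "differential S f x v = frechet_derivative f (at x within S) v"

definition vector_fields :: "'a::euclidean_space set \<Rightarrow> ('a \<Rightarrow> 'a set) \<Rightarrow> ('a \<Rightarrow> 'a) set" where
  "vector_fields S T = {V. smooth_sub S V \<and> (\<forall>x\<in>S. V x \<in> T x)}"

definition affine_connection ::
    "'a::euclidean_space set \<Rightarrow> ('a \<Rightarrow> 'a set) \<Rightarrow> (('a \<Rightarrow> 'a) \<Rightarrow> ('a \<Rightarrow> 'a) \<Rightarrow> ('a \<Rightarrow> 'a)) \<Rightarrow> bool" where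
  "affine_connection S T D \<longleftrightarrow>
     (\<forall>U\<in>vector_fields S T. \<forall>V\<in>vector_fields S T. D U V \<in> vector_fields S T) \<and>
     (\<forall>U\<in>vector_fields S T. \<forall>W\<in>vector_fields S T. \<forall>V\<in>vector_fields S T.
        \<forall>a b :: 'a \<Rightarrow> real. smooth_sub S a \<longrightarrow> smooth_sub S b \<longrightarrow>
          (\<forall>x\<in>S. D (\<lambda>y. a y *\<^sub>R U y + b y *\<^sub>R W y) V x = a x *\<^sub>R D U V x + b x *\<^sub>R D W V x)) \<and>
     (\<forall>U\<in>vector_fields S T. \<forall>V\<in>vector_fields S T. \<forall>W\<in>vector_fields S T.
        \<forall>x\<in>S. D U (\<lambda>y. V y + W y) x = D U V x + D U W x) \<and>
     (\<forall>U\<in>vector_fields S T. \<forall>V\<in>vector_fields S T.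
        \<forall>a :: 'a \<Rightarrow> real. smooth_sub S a \<longrightarrow>
          (\<forall>x\<in>S. D U (\<lambda>y. a y *\<^sub>R V y) x = differential S a x (U x) *\<^sub>R V x + a x *\<^sub>R D U V x))"

text \<open>\<open>\<nabla>\<^sub>U V - \<nabla>\<^sub>V U = [U, V]\<close>, with the Lie bracket as a derivation on smooth functions.\<close>

definition torsion_free ::
    "'a::euclidean_space set \<Rightarrow> ('a \<Rightarrow> 'a set) \<Rightarrow> (('a \<Rightarrow> 'a) \<Rightarrow> ('a \<Rightarrow> 'a) \<Rightarrow> ('a \<Rightarrow> 'a)) \<Rightarrow> bool" where
  "torsion_free S T D \<longleftrightarrow>
     (\<forall>U\<in>vector_fields S T. \<forall>V\<in>vector_fields S T.
        \<forall>h :: 'a \<Rightarrow> real. smooth_sub S h \<longrightarrow>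
          (\<forall>x\<in>S. differential S h x (D U V x - D V U x) =
             differential S (\<lambda>y. differential S h y (V y)) x (U x) -
             differential S (\<lambda>y. differential S h y (U y)) x (V x)))"

definition metric_compatible ::
    "'a::euclidean_space set \<Rightarrow> ('a \<Rightarrow> 'a set) \<Rightarrow> ('a \<Rightarrow> 'a \<Rightarrow> 'a \<Rightarrow> real) \<Rightarrow>
     (('a \<Rightarrow> 'a) \<Rightarrow> ('a \<Rightarrow> 'a) \<Rightarrow> ('a \<Rightarrow> 'a)) \<Rightarrow> bool" where
  "metric_compatible S T g D \<longleftrightarrow>
     (\<forall>U\<in>vector_fields S T. \<forall>V\<in>vector_fields S T. \<forall>W\<in>vector_fields S T.
        \<forall>x\<in>S. differential S (\<lambda>y. g y (V y) (W y)) x (U x) =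
          g x (D U V x) (W x) + g x (V x) (D U W x))"

text \<open>Choice only fixes the irrelevant values: on vector fields and at points of \<open>S\<close> the
  Levi-Civita connection is unique.\<close>

definition levi_civita ::
    "'a::euclidean_space set \<Rightarrow> ('a \<Rightarrow> 'a set) \<Rightarrow> ('a \<Rightarrow> 'a \<Rightarrow> 'a \<Rightarrow> real) \<Rightarrow>
     ('a \<Rightarrow> 'a) \<Rightarrow> ('a \<Rightarrow> 'a) \<Rightarrow> ('a \<Rightarrow> 'a)" where
  "levi_civita S T g =
     (SOME D. affine_connection S T D \<and> torsion_free S T D \<and> metric_compatible S T g D)"

text \<open>\<open>\<nabla>\<^sub>v W\<close> for a single tangent vector \<open>v\<close> at \<open>x\<close>: the value at \<open>x\<close> of \<open>\<nabla>\<^sub>V W\<close>, for any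
  vector field \<open>V\<close> extending \<open>v\<close>.\<close>

definition covariant_derivative ::
    "'a::euclidean_space set \<Rightarrow> ('a \<Rightarrow> 'a set) \<Rightarrow> ('a \<Rightarrow> 'a \<Rightarrow> 'a \<Rightarrow> real) \<Rightarrow>
     'a \<Rightarrow> 'a \<Rightarrow> ('a \<Rightarrow> 'a) \<Rightarrow> 'a" where
  "covariant_derivative S T g x v W =
     (THE z. \<forall>V\<in>vector_fields S T. V x = v \<longrightarrow> levi_civita S T g V W x = z)"

definition riemannian_gradient ::
    "'a::euclidean_space set \<Rightarrow> ('a \<Rightarrow> 'a set) \<Rightarrow> ('a \<Rightarrow> 'a \<Rightarrow> 'a \<Rightarrow> real) \<Rightarrow> ('a \<Rightarrow> real) \<Rightarrow> 'a \<Rightarrow> 'a" where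
  "riemannian_gradient S T g f x =
     (THE G. G \<in> T x \<and> (\<forall>v\<in>T x. g x G v = differential S f x v))"

definition riemannian_hessian ::
    "'a::euclidean_space set \<Rightarrow> ('a \<Rightarrow> 'a set) \<Rightarrow> ('a \<Rightarrow> 'a \<Rightarrow> 'a \<Rightarrow> real) \<Rightarrow> ('a \<Rightarrow> real) \<Rightarrow> 'a \<Rightarrow> 'a \<Rightarrow> 'a" where
  "riemannian_hessian S T g f x v =
     covariant_derivative S T g x v (riemannian_gradient S T g f)"

section \<open>The generalized Stiefel manifold\<close>

text \<open>A real \<open>d \<times> p\<close> matrix has type \<open>real^'p^'d\<close>.\<close>

definition sym_pos_def :: "real^'n^'n \<Rightarrow> bool" where
  "sym_pos_def A \<longleftrightarrow> transpose A = A \<and> (\<forall>v. v \<noteq> 0 \<longrightarrow> 0 < v \<bullet> (A *v v))"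

definition stiefel :: "real^'d^'d \<Rightarrow> (real^'p^'d) set" where
  "stiefel B = {X. transpose X ** B ** X = mat 1}"

definition stiefel_tangent :: "real^'d^'d \<Rightarrow> real^'p^'d \<Rightarrow> (real^'p^'d) set" where
  "stiefel_tangent B X = {Z. transpose Z ** B ** X + transpose X ** B ** Z = 0}"

definition trace_metric :: "real^'d^'d \<Rightarrow> real^'p^'d \<Rightarrow> real^'p^'d \<Rightarrow> real" where
  "trace_metric M U V = trace (transpose U ** M ** V)"

definition stiefel_gradient ::
    "real^'d^'d \<Rightarrow> real^'d^'d \<Rightarrow> (real^'p^'d \<Rightarrow> real) \<Rightarrow> real^'p^'d \<Rightarrow> real^'p^'d" where
  "stiefel_gradient B M f =
     riemannian_gradient (stiefel B) (stiefel_tangent B) (\<lambda>X. trace_metric M) f"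

definition stiefel_hessian ::
    "real^'d^'d \<Rightarrow> real^'d^'d \<Rightarrow> (real^'p^'d \<Rightarrow> real) \<Rightarrow> real^'p^'d \<Rightarrow> real^'p^'d \<Rightarrow> real^'p^'d" where
  "stiefel_hessian B M f =
     riemannian_hessian (stiefel B) (stiefel_tangent B) (\<lambda>X. trace_metric M) f"

definition stiefel_proj ::
    "real^'d^'d \<Rightarrow> real^'d^'d \<Rightarrow> real^'p^'d \<Rightarrow> real^'p^'d \<Rightarrow> real^'p^'d" where
  "stiefel_proj B M X U =
     (THE P. P \<in> stiefel_tangent B X \<and> (\<forall>Z\<in>stiefel_tangent B X. trace_metric M (U - P) Z = 0))"

definition euclidean_gradient :: "(real^'p^'d \<Rightarrow> real) \<Rightarrow> real^'p^'d \<Rightarrow> real^'p^'d" where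
  "euclidean_gradient f X = (THE G. (f has_derivative (\<lambda>H. trace (transpose G ** H))) (at X))"

definition euclidean_hessian ::
    "(real^'p^'d \<Rightarrow> real) \<Rightarrow> real^'p^'d \<Rightarrow> real^'p^'d \<Rightarrow> real^'p^'d" where
  "euclidean_hessian f X H = frechet_derivative (euclidean_gradient f) (at X) H"

end

theory Submission
  imports Defs
begin

text \<open>
  Write \<open>\<langle>U, V\<rangle> = Tr (U\<^sup>T M V)\<close>. The normal space of \<open>St\<^sub>B\<close> at \<open>X\<close> consists of the matrices
  \<open>M\<^sup>-\<^sup>1 B X W\<close> with \<open>W\<close> symmetric. Hence \<open>grad f(X) = M\<^sup>-\<^sup>1 \<nabla>fbar(X) - M\<^sup>-\<^sup>1 B X W(X)\<close> for a symmetric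
  multiplier \<open>W(X)\<close>, and multiplication by \<open>X\<^sup>T M\<close> identifies
  \<open>W(X) = X\<^sup>T \<nabla>fbar(X) - X\<^sup>T M grad f(X)\<close>. The metric is constant, so the Levi-Civita connection
  is the ambient derivative followed by the orthogonal projection \<open>\<Pi>\<^sub>X\<close>. Differentiating the formula
  for \<open>grad f\<close> along \<open>\<eta>\<close> gives
  \<open>M\<^sup>-\<^sup>1 \<nabla>\<^sup>2fbar(X) \<eta> - M\<^sup>-\<^sup>1 B \<eta> W(X) - M\<^sup>-\<^sup>1 B X DW(X)[\<eta>]\<close>. Since \<open>W\<close> takes symmetric values, so does
  its derivative, hence the last term is normal and \<open>\<Pi>\<^sub>X\<close> removes it.

  Two points need work. The first is that the multiplier, and with it \<open>\<Pi>\<close>, depends smoothly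
  on \<open>X\<close>: \<open>W\<close> solves the Lyapunov equation \<open>A(X) W + W A(X) = X\<^sup>T B U + U\<^sup>T B X\<close> with \<open>A(X)\<close> positive
  definite, and \<open>smooth_open_solution\<close> shows that the solution of an injective linear equation is as
  smooth as its data. The matrix \<open>A(X)\<close> (\<open>gram\<close> below) is chosen positive definite on the whole
  ambient space, so that \<open>\<Pi>\<close> has a global smooth extension.

  The second is that the Levi-Civita connection really is the projected derivative. This is done in
  the locale \<open>projected_submanifold\<close>, for any set whose tangent vectors are velocities of curves and
  which has a smooth family of orthogonal projections onto the tangent spaces. Existence rests on
  \<open>bracket_tangent\<close>, that is, on the symmetry of second derivatives; uniqueness
  (\<open>connection_unique\<close>) on the fact that a trilinear form symmetric in two slots and skew in two slots
  vanishes. For the Stiefel manifold the curves are Cayley transforms (\<open>tangent_curve\<close>).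
\<close>

section \<open>Calculus of smooth maps\<close>

lemma has_derivative_imp_frechet:
  assumes "(f has_derivative f') (at x)"
  shows "frechet_derivative f (at x) = f'"
  using frechet_derivative_at[OF assms] by simp

lemma cont_diff_subset: "cont_diff k U f \<Longrightarrow> V \<subseteq> U \<Longrightarrow> cont_diff k V f"
  by (induction k arbitrary: f) (auto intro: continuous_on_subset)

text \<open>Derivatives at a point of an open set only see the germ of the function. This lets each step
  from class \<open>k\<close> to class \<open>k + 1\<close> below replace the chosen derivative by an explicit formula.\<close>

lemma cont_diff_cong:
  assumes "open U" "\<And>x. x \<in> U \<Longrightarrow> f x = g x"
  shows "cont_diff k U f \<longleftrightarrow> cont_diff k U g"
  using assms(2)
proof (induction k arbitrary: f g)
  case 0
  then show ?case by (auto cong: continuous_on_cong)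
next
  case (Suc k)
  have hd: "(f has_derivative f') (at x) \<longleftrightarrow> (g has_derivative f') (at x)" if "x \<in> U" for x f'
    using has_derivative_transform_within_open[of f f' x UNIV U g]
      has_derivative_transform_within_open[of g f' x UNIV U f] assms(1) that Suc.prems by auto
  have d: "f differentiable (at x) \<longleftrightarrow> g differentiable (at x)" if "x \<in> U" for x
    using hd[OF that] by (auto simp: differentiable_def)
  have fd: "frechet_derivative f (at x) = frechet_derivative g (at x)" if "x \<in> U" for x
    using hd[OF that] by (auto simp: frechet_derivative_def)
  have "cont_diff k U (\<lambda>x. frechet_derivative f (at x) v) \<longleftrightarrow>
      cont_diff k U (\<lambda>x. frechet_derivative g (at x) v)" for v
    by (rule Suc.IH) (simp add: fd)
  then show ?case using d by auto
qed

lemma cont_diff_SucI: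
  assumes "open U"
    and "\<And>x. x \<in> U \<Longrightarrow> (f has_derivative f' x) (at x)"
    and "\<And>v. cont_diff k U (\<lambda>x. f' x v)"
  shows "cont_diff (Suc k) U f"
proof -
  have "cont_diff k U (\<lambda>x. frechet_derivative f (at x) v)" for v
    by (rule cont_diff_cong[OF assms(1), THEN iffD1, OF _ assms(3)[of v]])
      (simp add: has_derivative_imp_frechet[OF assms(2)])
  then show ?thesis using assms(2) by (auto simp: differentiable_def)
qed

lemma cont_diff_Suc_has_derivative:
  "cont_diff (Suc k) U f \<Longrightarrow> x \<in> U \<Longrightarrow>
    (f has_derivative frechet_derivative f (at x)) (at x)"
  by (simp add: frechet_derivative_works)

lemma cont_diff_Suc_imp: "cont_diff (Suc k) U f \<Longrightarrow> cont_diff k U f"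
proof (induction k arbitrary: f)
  case 0
  then show ?case
    by (simp add: continuous_at_imp_continuous_on differentiable_imp_continuous_within)
next
  case (Suc k)
  then show ?case by (metis cont_diff.simps(2))
qed

lemma cont_diff_const: "cont_diff k U (\<lambda>x. c)"
  by (induction k arbitrary: c) auto

lemma cont_diff_add:
  assumes "open U"
  shows "cont_diff k U f \<Longrightarrow> cont_diff k U g \<Longrightarrow> cont_diff k U (\<lambda>x. f x + g x)"
proof (induction k arbitrary: f g)
  case 0
  then show ?case by (simp add: continuous_on_add)
next
  case (Suc k)
  show ?case
  proof (rule cont_diff_SucI[OF assms])
    show "((\<lambda>x. f x + g x) has_derivative
        (\<lambda>v. frechet_derivative f (at x) v + frechet_derivative g (at x) v)) (at x)" if "x \<in> U" for x
      by (rule has_derivative_add[OF cont_diff_Suc_has_derivative[OF Suc.prems(1) that]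
            cont_diff_Suc_has_derivative[OF Suc.prems(2) that]])
    show "cont_diff k U (\<lambda>x. frechet_derivative f (at x) v + frechet_derivative g (at x) v)" for v
      by (rule Suc.IH) (use Suc.prems in auto)
  qed
qed

lemma cont_diff_bounded_linear:
  assumes "open U" "bounded_linear L"
  shows "cont_diff k U f \<Longrightarrow> cont_diff k U (\<lambda>x. L (f x))"
proof (induction k arbitrary: f)
  case 0
  then have "continuous_on U f" by simp
  from bounded_linear.continuous_on[OF assms(2) this] show ?case by simp
next
  case (Suc k)
  show ?case
  proof (rule cont_diff_SucI[OF assms(1)])
    show "((\<lambda>x. L (f x)) has_derivative (\<lambda>v. L (frechet_derivative f (at x) v))) (at x)"
      if "x \<in> U" for x
      by (rule bounded_linear.has_derivative[OF assms(2)
            cont_diff_Suc_has_derivative[OF Suc.prems that]])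
    show "cont_diff k U (\<lambda>x. L (frechet_derivative f (at x) v))" for v
      by (rule Suc.IH) (use Suc.prems in auto)
  qed
qed

lemma cont_diff_ident: "cont_diff k U (\<lambda>x. x)"
  by (cases k) (auto simp: cont_diff_const)

lemma cont_diff_bilinear:
  assumes "open U" "bounded_bilinear b"
  shows "cont_diff k U f \<Longrightarrow> cont_diff k U g \<Longrightarrow> cont_diff k U (\<lambda>x. b (f x) (g x))"
proof (induction k arbitrary: f g)
  case 0
  then have "continuous_on U f" "continuous_on U g" by simp_all
  from bounded_bilinear.continuous_on[OF assms(2) this] show ?case by simp
next
  case (Suc k)
  show ?case
  proof (rule cont_diff_SucI[OF assms(1)])
    show "((\<lambda>x. b (f x) (g x)) has_derivative
        (\<lambda>v. b (f x) (frechet_derivative g (at x) v) + b (frechet_derivative f (at x) v) (g x))) (at x)"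
      if "x \<in> U" for x
      by (rule bounded_bilinear.FDERIV[OF assms(2) cont_diff_Suc_has_derivative[OF Suc.prems(1) that]
            cont_diff_Suc_has_derivative[OF Suc.prems(2) that]])
    show "cont_diff k U (\<lambda>x. b (f x) (frechet_derivative g (at x) v) +
        b (frechet_derivative f (at x) v) (g x))" for v
      using Suc.prems by (intro cont_diff_add[OF assms(1)] Suc.IH) (auto intro: cont_diff_Suc_imp)
  qed
qed

lemma smooth_open_subset: "smooth_open U f \<Longrightarrow> V \<subseteq> U \<Longrightarrow> smooth_open V f"
  unfolding smooth_open_def using cont_diff_subset by blast

lemma smooth_open_cong:
  assumes "open U" "\<And>x. x \<in> U \<Longrightarrow> f x = g x"
  shows "smooth_open U f \<longleftrightarrow> smooth_open U g"
  unfolding smooth_open_def using cont_diff_cong[OF assms] by simp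

lemma smooth_open_const: "smooth_open U (\<lambda>x. c)"
  by (simp add: smooth_open_def cont_diff_const)

lemma smooth_open_ident: "smooth_open U (\<lambda>x. x)"
  by (simp add: smooth_open_def cont_diff_ident)

lemma smooth_open_add:
  "open U \<Longrightarrow> smooth_open U f \<Longrightarrow> smooth_open U g \<Longrightarrow> smooth_open U (\<lambda>x. f x + g x)"
  by (simp add: smooth_open_def cont_diff_add)

lemma smooth_open_bounded_linear:
  "open U \<Longrightarrow> bounded_linear L \<Longrightarrow> smooth_open U f \<Longrightarrow> smooth_open U (\<lambda>x. L (f x))"
  by (simp add: smooth_open_def cont_diff_bounded_linear)

lemma smooth_open_bilinear:
  "open U \<Longrightarrow> bounded_bilinear b \<Longrightarrow> smooth_open U f \<Longrightarrow> smooth_open U g \<Longrightarrow>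
    smooth_open U (\<lambda>x. b (f x) (g x))"
  by (simp add: smooth_open_def cont_diff_bilinear)

lemma smooth_open_diff:
  fixes f g :: "'a::euclidean_space \<Rightarrow> 'b::real_normed_vector"
  assumes "open U" "smooth_open U f" "smooth_open U g"
  shows "smooth_open U (\<lambda>x. f x - g x)"
  using smooth_open_add[OF assms(1,2) smooth_open_bounded_linear[OF assms(1)
      bounded_linear_minus[OF bounded_linear_ident] assms(3)]] by simp

lemma smooth_open_sum:
  assumes "open U"
  shows "finite I \<Longrightarrow> (\<And>i. i \<in> I \<Longrightarrow> smooth_open U (f i)) \<Longrightarrow> smooth_open U (\<lambda>x. \<Sum>i\<in>I. f i x)"
proof (induction I rule: finite_induct)
  case empty
  then show ?case by (simp add: smooth_open_const)
next
  case (insert i I)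
  then show ?case by (simp add: smooth_open_add[OF assms])
qed

lemma smooth_open_frechet: "smooth_open U f \<Longrightarrow> smooth_open U (\<lambda>x. frechet_derivative f (at x) v)"
  unfolding smooth_open_def by (metis cont_diff.simps(2))

lemma smooth_open_has_derivative:
  "smooth_open U f \<Longrightarrow> x \<in> U \<Longrightarrow> (f has_derivative frechet_derivative f (at x)) (at x)"
  unfolding smooth_open_def by (metis cont_diff_Suc_has_derivative)

lemma smooth_open_isCont: "smooth_open U f \<Longrightarrow> x \<in> U \<Longrightarrow> isCont f x"
  using smooth_open_has_derivative has_derivative_continuous by blast

lemma linear_sum_Basis:
  fixes L :: "'a::euclidean_space \<Rightarrow> 'b::real_vector"
  assumes "linear L"
  shows "L v = (\<Sum>i\<in>Basis. (v \<bullet> i) *\<^sub>R L i)"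
proof -
  have "L v = L (\<Sum>i\<in>Basis. (v \<bullet> i) *\<^sub>R i)" by (simp add: euclidean_representation)
  also have "\<dots> = (\<Sum>i\<in>Basis. (v \<bullet> i) *\<^sub>R L i)"
    using assms by (simp add: linear_sum linear_scale o_def)
  finally show ?thesis .
qed

text \<open>Expanding \<open>w x\<close> in the standard basis reduces the smoothness of \<open>L x (w x)\<close>, where the argument
  moves too, to the smoothness of \<open>L\<close> at fixed vectors.\<close>

lemma smooth_open_linear_apply:
  fixes L :: "'a::euclidean_space \<Rightarrow> 'c::euclidean_space \<Rightarrow> 'b::real_normed_vector"
  assumes "open U" and lin: "\<And>x. x \<in> U \<Longrightarrow> linear (L x)"
    and L: "\<And>v. smooth_open U (\<lambda>x. L x v)" and w: "smooth_open U w"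
  shows "smooth_open U (\<lambda>x. L x (w x))"
proof -
  have "smooth_open U (\<lambda>x. \<Sum>i\<in>Basis. (w x \<bullet> i) *\<^sub>R L x i)"
    by (rule smooth_open_sum[OF assms(1) finite_Basis])
      (rule smooth_open_bilinear[OF assms(1) bounded_bilinear_scaleR
          smooth_open_bounded_linear[OF assms(1) bounded_linear_inner_left w] L])
  then show ?thesis
    by (rule smooth_open_cong[OF assms(1), THEN iffD2, rotated]) (rule linear_sum_Basis[OF lin])
qed

lemma smooth_open_frechet_field:
  assumes "open U" "smooth_open U f" "smooth_open U w"
  shows "smooth_open U (\<lambda>x. frechet_derivative f (at x) (w x))"
proof (rule smooth_open_linear_apply[OF assms(1)])
  show "linear (frechet_derivative f (at x))" if "x \<in> U" for x
    using smooth_open_has_derivative[OF assms(2) that] has_derivative_linear by blast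
qed (use assms smooth_open_frechet in auto)

text \<open>Product rule for the derivative of \<open>f\<close> along a moving direction \<open>w\<close>. This is where second
  derivatives enter, both in the Lie bracket and in the torsion.\<close>

lemma frechet_field_has_derivative:
  assumes U: "open U" "x \<in> U" and f: "smooth_open U f" and w: "smooth_open U w"
  shows "((\<lambda>y. frechet_derivative f (at y) (w y)) has_derivative
    (\<lambda>u. frechet_derivative f (at x) (frechet_derivative w (at x) u) +
         frechet_derivative (\<lambda>y. frechet_derivative f (at y) (w x)) (at x) u)) (at x)"
proof -
  have lin: "linear (frechet_derivative f (at y))" if "y \<in> U" for y
    using smooth_open_has_derivative[OF f that] has_derivative_linear by blast
  let ?D = "\<lambda>i y. frechet_derivative f (at y) i"
  have D: "(?D i has_derivative frechet_derivative (?D i) (at x)) (at x)" for i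
    by (rule smooth_open_has_derivative[OF smooth_open_frechet[OF f] U(2)])
  have w': "(w has_derivative frechet_derivative w (at x)) (at x)"
    by (rule smooth_open_has_derivative[OF w U(2)])
  have "((\<lambda>y. \<Sum>i\<in>Basis. (c \<bullet> i) *\<^sub>R ?D i y) has_derivative
      (\<lambda>u. \<Sum>i\<in>Basis. (c \<bullet> i) *\<^sub>R frechet_derivative (?D i) (at x) u)) (at x)" for c
    by (intro has_derivative_sum has_derivative_scaleR_right D)
  then have "((\<lambda>y. frechet_derivative f (at y) c) has_derivative
      (\<lambda>u. \<Sum>i\<in>Basis. (c \<bullet> i) *\<^sub>R frechet_derivative (?D i) (at x) u)) (at x)" for c
    by (rule has_derivative_transform_within_open[OF _ U])
      (rule linear_sum_Basis[OF lin, symmetric])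
  then have second: "frechet_derivative (\<lambda>y. frechet_derivative f (at y) c) (at x) =
      (\<lambda>u. \<Sum>i\<in>Basis. (c \<bullet> i) *\<^sub>R frechet_derivative (?D i) (at x) u)" for c
    by (rule has_derivative_imp_frechet)
  have "((\<lambda>y. \<Sum>i\<in>Basis. (w y \<bullet> i) *\<^sub>R ?D i y) has_derivative
      (\<lambda>u. \<Sum>i\<in>Basis. (w x \<bullet> i) *\<^sub>R frechet_derivative (?D i) (at x) u +
        (frechet_derivative w (at x) u \<bullet> i) *\<^sub>R ?D i x)) (at x)"
    by (rule has_derivative_sum)
      (rule has_derivative_scaleR[OF has_derivative_inner_left[OF w'] D])
  then have "((\<lambda>y. frechet_derivative f (at y) (w y)) has_derivative
      (\<lambda>u. \<Sum>i\<in>Basis. (w x \<bullet> i) *\<^sub>R frechet_derivative (?D i) (at x) u +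
        (frechet_derivative w (at x) u \<bullet> i) *\<^sub>R ?D i x)) (at x)"
    by (rule has_derivative_transform_within_open[OF _ U])
      (rule linear_sum_Basis[OF lin, symmetric])
  moreover have "(\<Sum>i\<in>Basis. (w x \<bullet> i) *\<^sub>R frechet_derivative (?D i) (at x) u +
        (frechet_derivative w (at x) u \<bullet> i) *\<^sub>R ?D i x) =
      frechet_derivative f (at x) (frechet_derivative w (at x) u) +
         frechet_derivative (\<lambda>y. frechet_derivative f (at y) (w x)) (at x) u" for u
    unfolding second[of "w x"] using linear_sum_Basis[OF lin[OF U(2)], of "frechet_derivative w (at x) u"]
    by (simp add: sum.distrib)
  ultimately show ?thesis by simp
qed

section \<open>Linear equations with smooth coefficients\<close>

text \<open>A product rule that needs only continuity of the second factor, because the first one vanishes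
  at the point. It is what makes a solution differentiable before anything but its continuity is
  known.\<close>

lemma has_derivative_bilinear_vanishing:
  fixes f :: "'a::real_normed_vector \<Rightarrow> 'b::real_normed_vector"
    and g :: "'a \<Rightarrow> 'c::real_normed_vector" and b :: "'b \<Rightarrow> 'c \<Rightarrow> 'd::real_normed_vector"
  assumes b: "bounded_bilinear b"
    and f: "(f has_derivative f') (at x)" and "f x = 0" and g: "isCont g x"
  shows "((\<lambda>y. b (f y) (g y)) has_derivative (\<lambda>v. b (f' v) (g x))) (at x)"
proof -
  interpret b: bounded_bilinear b by fact
  obtain K where K: "\<And>u w. norm (b u w) \<le> norm u * norm w * K" "K \<ge> 0"
    using b.nonneg_bounded by blast
  obtain C where C: "\<And>v. norm (f' v) \<le> norm v * C"
    using bounded_linear.bounded[OF has_derivative_bounded_linear[OF f]] by blast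
  have 0: "b 0 w = 0" for w by (rule b.zero_left)
  have rest: "((\<lambda>y. b (f y) (g y - g x)) has_derivative (\<lambda>v. 0)) (at x)"
    unfolding has_derivative_iff_norm
  proof (intro conjI bounded_linear_zero)
    let ?q = "\<lambda>y. norm ((f y - f x) - f' (y - x)) / norm (y - x)"
    have q: "(?q \<longlongrightarrow> 0) (at x)"
      using f unfolding has_derivative_iff_norm by simp
    have gl: "((\<lambda>y. norm (g y - g x)) \<longlongrightarrow> 0) (at x)"
      using g unfolding isCont_def by (simp add: LIM_zero tendsto_norm_zero)
    have lim: "((\<lambda>y. (?q y + C) * norm (g y - g x) * K) \<longlongrightarrow> 0) (at x)"
      using tendsto_mult[OF tendsto_mult[OF tendsto_add[OF q tendsto_const] gl] tendsto_const] by simp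
    show "((\<lambda>y. norm (b (f y) (g y - g x) - b (f x) (g x - g x) - 0) / norm (y - x)) \<longlongrightarrow> 0) (at x)"
    proof (rule tendsto_sandwich[OF _ _ tendsto_const lim])
      show "\<forall>\<^sub>F y in at x. norm (b (f y) (g y - g x) - b (f x) (g x - g x) - 0) / norm (y - x)
          \<le> (?q y + C) * norm (g y - g x) * K"
      proof (rule eventually_at_filter[THEN iffD2], rule always_eventually, intro allI impI)
        fix y assume "y \<noteq> x"
        then have n: "norm (y - x) > 0" by simp
        have "norm (f y) \<le> norm ((f y - f x) - f' (y - x)) + norm (f' (y - x))"
          using norm_triangle_ineq[of "(f y - f x) - f' (y - x)" "f' (y - x)"] assms(3) by simp
        also have "\<dots> \<le> (?q y + C) * norm (y - x)"
          using C[of "y - x"] n by (simp add: field_simps)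
        finally have fy: "norm (f y) \<le> (?q y + C) * norm (y - x)" .
        have "norm (b (f y) (g y - g x)) \<le> norm (f y) * (norm (g y - g x) * K)"
          using K(1)[of "f y" "g y - g x"] by (simp add: mult.assoc)
        also have "\<dots> \<le> ((?q y + C) * norm (y - x)) * (norm (g y - g x) * K)"
          using K(2) by (intro mult_right_mono fy) simp
        finally have "norm (b (f y) (g y - g x)) / norm (y - x) \<le> (?q y + C) * norm (g y - g x) * K"
          by (subst pos_divide_le_eq[OF n]) (simp add: mult_ac)
        then show "norm (b (f y) (g y - g x) - b (f x) (g x - g x) - 0) / norm (y - x)
          \<le> (?q y + C) * norm (g y - g x) * K"
          by (simp add: b.zero_right)
      qed
    qed simp
  qed
  have main: "((\<lambda>y. b (f y) (g x)) has_derivative (\<lambda>v. b (f' v) (g x))) (at x)"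
    by (rule bounded_linear.has_derivative[OF b.bounded_linear_left f])
  show ?thesis
    using has_derivative_add[OF main rest] by (simp add: b.diff_right)
qed

text \<open>With \<open>G\<close> a left inverse of \<open>b (a x)\<close>, the equation becomes the fixed-point identity
  \<open>s y = G (r y - b (a y - a x) (s y))\<close>. The lower bound for \<open>b (a x)\<close> bounds \<open>s\<close> near \<open>x\<close>, so the
  correction term tends to \<open>0\<close>.\<close>

lemma solution_isCont:
  fixes b :: "'e::real_normed_vector \<Rightarrow> 'b::euclidean_space \<Rightarrow> 'c::euclidean_space"
    and s :: "'a::real_normed_vector \<Rightarrow> 'b"
  assumes b: "bounded_bilinear b" and a: "isCont a x" and r: "isCont r x"
    and inj: "\<And>w. b (a x) w = 0 \<Longrightarrow> w = 0"
    and U: "open U" "x \<in> U" and eq: "\<And>y. y \<in> U \<Longrightarrow> b (a y) (s y) = r y"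
  shows "isCont s x"
proof -
  interpret b: bounded_bilinear b by fact
  have lin: "linear (b (a x))"
    using b.bounded_linear_right bounded_linear.linear by blast
  have "inj (b (a x))"
    using inj linear_injective_0[OF lin] by blast
  then obtain c where c: "c > 0" "\<And>w. c * norm w \<le> norm (b (a x) w)"
    using linear_inj_bounded_below_pos[OF lin] by blast
  obtain G where G: "linear G" "\<And>w. G (b (a x) w) = w"
    using linear_injective_left_inverse[OF lin \<open>inj _\<close>] by (auto simp: fun_eq_iff)
  then have blG: "bounded_linear G" by (simp add: linear_conv_bounded_linear)
  obtain K where K: "\<And>u w. norm (b u w) \<le> norm u * norm w * K" "K > 0"
    using b.pos_bounded by blast
  have split: "b (a x) (s y) = r y - b (a y - a x) (s y)" if "y \<in> U" for y
    using eq[OF that] by (simp add: b.diff_left)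
  then have sol: "s y = G (r y - b (a y - a x) (s y))" if "y \<in> U" for y
    using G(2) that by metis
  have evU: "\<forall>\<^sub>F y in at x. y \<in> U" using U by (rule eventually_at_in_open')
  have ac: "((\<lambda>y. a y - a x) \<longlongrightarrow> 0) (at x)"
    using a by (simp add: isCont_def LIM_zero)
  have rc: "(r \<longlongrightarrow> r x) (at x)"
    using r by (simp add: isCont_def)
  have "Bfun s (at x)"
  proof (rule BfunI)
    have e1: "\<forall>\<^sub>F y in at x. norm (a y - a x) < c / (2 * K)"
      using tendstoD[OF ac, of "c / (2*K)"] c K by (simp add: dist_norm)
    have e2: "\<forall>\<^sub>F y in at x. norm (r y) < norm (r x) + 1"
      using order_tendstoD(2)[OF tendsto_norm[OF rc], of "norm (r x) + 1"] by simp
    show "\<forall>\<^sub>F y in at x. norm (s y) \<le> 2 / c * (norm (r x) + 1)"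
      using evU e1 e2
    proof eventually_elim
      case (elim y)
      have "norm (b (a y - a x) (s y)) \<le> (norm (a y - a x) * K) * norm (s y)"
        using K(1)[of "a y - a x" "s y"] by (simp add: mult_ac)
      also have "\<dots> \<le> (c / 2) * norm (s y)"
        using elim(2) K(2) by (intro mult_right_mono) (auto simp: field_simps)
      finally have h: "norm (b (a y - a x) (s y)) \<le> (c / 2) * norm (s y)" .
      have "c * norm (s y) \<le> norm (r y) + norm (b (a y - a x) (s y))"
        using c(2)[of "s y"] split[OF elim(1)] norm_triangle_ineq4[of "r y" "b (a y - a x) (s y)"]
        by simp
      then have "(c / 2) * norm (s y) \<le> norm (r x) + 1"
        using h elim(3) by simp
      then show ?case using c(1) by (simp add: field_simps)
    qed
  qed
  then have "((\<lambda>y. b (a y - a x) (s y)) \<longlongrightarrow> 0) (at x)"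
    using b.Zfun_prod_Bfun[of "\<lambda>y. a y - a x" "at x" s] ac by (simp add: tendsto_Zfun_iff)
  from tendsto_diff[OF rc this]
  have "((\<lambda>y. G (r y - b (a y - a x) (s y))) \<longlongrightarrow> G (r x)) (at x)"
    using bounded_linear.tendsto[OF blG] by fastforce
  moreover have "G (r x) = s x" using sol[OF U(2)] by (simp add: b.zero_left)
  moreover have "\<forall>\<^sub>F y in at x. s y = G (r y - b (a y - a x) (s y))"
    using evU by eventually_elim (rule sol)
  ultimately show "isCont s x"
    unfolding isCont_def using tendsto_cong by fastforce
qed

text \<open>The same identity, differentiated: its correction term is a product whose first factor
  vanishes at \<open>x\<close>. The formula for the derivative is again an equation with coefficient \<open>a\<close>, so
  it both determines the derivative and drives the induction on the order of smoothness.\<close>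

lemma solution_has_derivative:
  fixes b :: "'e::real_normed_vector \<Rightarrow> 'b::euclidean_space \<Rightarrow> 'c::euclidean_space"
    and s :: "'a::real_normed_vector \<Rightarrow> 'b"
  assumes b: "bounded_bilinear b"
    and a: "(a has_derivative a') (at x)" and r: "(r has_derivative r') (at x)"
    and inj: "\<And>w. b (a x) w = 0 \<Longrightarrow> w = 0"
    and U: "open U" "x \<in> U" and eq: "\<And>y. y \<in> U \<Longrightarrow> b (a y) (s y) = r y"
  shows "\<exists>s'. (s has_derivative s') (at x) \<and> (\<forall>v. b (a x) (s' v) = r' v - b (a' v) (s x))"
proof -
  interpret b: bounded_bilinear b by fact
  have lin: "linear (b (a x))"
    using b.bounded_linear_right bounded_linear.linear by blast
  have "inj (b (a x))"
    using inj linear_injective_0[OF lin] by blast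
  then obtain G where G: "linear G" "\<And>w. G (b (a x) w) = w"
    using linear_injective_left_inverse[OF lin] by (auto simp: fun_eq_iff)
  then have blG: "bounded_linear G" by (simp add: linear_conv_bounded_linear)
  have "b (a x) (s y) = r y - b (a y - a x) (s y)" if "y \<in> U" for y
    using eq[OF that] by (simp add: b.diff_left)
  then have sol: "s y = G (r y - b (a y - a x) (s y))" if "y \<in> U" for y
    using G(2) that by metis
  have "isCont s x"
    by (rule solution_isCont[OF b _ _ inj U eq]) (use a r has_derivative_continuous in auto)
  then have "((\<lambda>y. b (a y - a x) (s y)) has_derivative (\<lambda>v. b (a' v) (s x))) (at x)"
    using a by (intro has_derivative_bilinear_vanishing[OF b]) (auto intro!: derivative_eq_intros)
  then have "((\<lambda>y. G (r y - b (a y - a x) (s y))) has_derivative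
      (\<lambda>v. G (r' v - b (a' v) (s x)))) (at x)"
    by (intro bounded_linear.has_derivative[OF blG has_derivative_diff[OF r]])
  then have ds: "(s has_derivative (\<lambda>v. G (r' v - b (a' v) (s x)))) (at x)"
    by (rule has_derivative_transform_within_open[OF _ U]) (simp add: sol[symmetric])
  then have "((\<lambda>y. b (a y) (s y)) has_derivative
      (\<lambda>v. b (a x) (G (r' v - b (a' v) (s x))) + b (a' v) (s x))) (at x)"
    by (intro b.FDERIV a)
  then have "(r has_derivative
      (\<lambda>v. b (a x) (G (r' v - b (a' v) (s x))) + b (a' v) (s x))) (at x)"
    by (rule has_derivative_transform_within_open[OF _ U]) (simp add: eq)
  then have "r' = (\<lambda>v. b (a x) (G (r' v - b (a' v) (s x))) + b (a' v) (s x))"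
    by (rule has_derivative_unique[OF r])
  then have "\<forall>v. b (a x) (G (r' v - b (a' v) (s x))) = r' v - b (a' v) (s x)"
    by (metis add_diff_cancel_right')
  then show ?thesis using ds by blast
qed

text \<open>The directional derivative of \<open>s\<close> solves the equation with the same coefficient \<open>a\<close> and the
  right-hand side \<open>r' - b a' s\<close>, which has class \<open>k\<close> if \<open>s\<close> has. The induction therefore
  generalizes over \<open>r\<close> and \<open>s\<close>.\<close>

lemma cont_diff_solution:
  fixes b :: "'e::real_normed_vector \<Rightarrow> 'b::euclidean_space \<Rightarrow> 'c::euclidean_space"
    and s :: "'a::euclidean_space \<Rightarrow> 'b"
  assumes b: "bounded_bilinear b" and U: "open U"
    and inj: "\<And>x w. x \<in> U \<Longrightarrow> b (a x) w = 0 \<Longrightarrow> w = 0"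
  shows "\<lbrakk>cont_diff k U a; cont_diff k U r; \<And>x. x \<in> U \<Longrightarrow> b (a x) (s x) = r x\<rbrakk> \<Longrightarrow> cont_diff k U s"
proof (induction k arbitrary: r s)
  case (0 r s)
  have "isCont s x" if "x \<in> U" for x
    using solution_isCont[OF b _ _ inj[OF that] U that 0(3)] 0(1,2) that U
    by (simp add: continuous_on_eq_continuous_at)
  then show ?case by (simp add: continuous_at_imp_continuous_on)
next
  case (Suc k r s)
  let ?da = "\<lambda>x. frechet_derivative a (at x)" and ?dr = "\<lambda>x. frechet_derivative r (at x)"
  have "\<exists>s'. (s has_derivative s') (at x) \<and>
      (\<forall>v. b (a x) (s' v) = ?dr x v - b (?da x v) (s x))" if "x \<in> U" for x
    using solution_has_derivative[OF b cont_diff_Suc_has_derivative[OF Suc.prems(1) that]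
        cont_diff_Suc_has_derivative[OF Suc.prems(2) that] inj[OF that] U that Suc.prems(3)] by blast
  then obtain s' where s': "\<And>x. x \<in> U \<Longrightarrow> (s has_derivative s' x) (at x)"
    "\<And>x v. x \<in> U \<Longrightarrow> b (a x) (s' x v) = ?dr x v - b (?da x v) (s x)"
    by metis
  have a: "cont_diff k U a" and r: "cont_diff k U r"
    using Suc.prems by (auto intro: cont_diff_Suc_imp)
  have s: "cont_diff k U s" by (rule Suc.IH[OF a r Suc.prems(3)])
  show ?case
  proof (rule cont_diff_SucI[OF U s'(1)])
    fix v
    show "cont_diff k U (\<lambda>x. s' x v)"
    proof (rule Suc.IH[OF a _ s'(2)])
      have "cont_diff k U (\<lambda>x. ?dr x v + - b (?da x v) (s x))"
        using Suc.prems s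
        by (intro cont_diff_add cont_diff_bilinear[OF U b] cont_diff_bounded_linear[where L=uminus]
            bounded_linear_minus bounded_linear_ident U) auto
      then show "cont_diff k U (\<lambda>x. ?dr x v - b (?da x v) (s x))" by simp
    qed
  qed
qed

lemma smooth_open_solution:
  fixes b :: "'e::real_normed_vector \<Rightarrow> 'b::euclidean_space \<Rightarrow> 'c::euclidean_space"
    and s :: "'a::euclidean_space \<Rightarrow> 'b"
  assumes "bounded_bilinear b" "open U" "\<And>x w. x \<in> U \<Longrightarrow> b (a x) w = 0 \<Longrightarrow> w = 0"
    and "smooth_open U a" "smooth_open U r" "\<And>x. x \<in> U \<Longrightarrow> b (a x) (s x) = r x"
  shows "smooth_open U s"
  unfolding smooth_open_def
  by (rule allI, rule cont_diff_solution[OF assms(1-3) _ _ assms(6)])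
    (use assms(4,5) in \<open>simp_all add: smooth_open_def\<close>)

section \<open>Symmetry of second derivatives\<close>

text \<open>Two applications of the mean value theorem turn the second difference quotient into a value of
  the iterated derivative near \<open>x\<close>. The quotient is symmetric in \<open>u\<close> and \<open>v\<close>, hence so is its limit.\<close>

lemma second_difference_limit:
  fixes h :: "'a::euclidean_space \<Rightarrow> real"
  assumes U: "open U" "x \<in> U" and h: "smooth_open U h"
  shows "((\<lambda>\<tau>. (h (x + \<tau> *\<^sub>R u + \<tau> *\<^sub>R v) - h (x + \<tau> *\<^sub>R u) - h (x + \<tau> *\<^sub>R v) + h x) / \<tau>\<^sup>2)
     \<longlongrightarrow> frechet_derivative (\<lambda>y. frechet_derivative h (at y) u) (at x) v) (at_right 0)"
proof (rule tendstoI)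
  fix e :: real assume "e > 0"
  define k where "k = (\<lambda>y. frechet_derivative h (at y) u)"
  define l where "l = (\<lambda>y. frechet_derivative k (at y) v)"
  have k: "smooth_open U k" unfolding k_def by (rule smooth_open_frechet[OF h])
  have l: "smooth_open U l" unfolding l_def by (rule smooth_open_frechet[OF k])
  have "\<forall>\<^sub>F y in nhds x. y \<noteq> x \<longrightarrow> dist (l y) (l x) < e"
    using smooth_open_isCont[OF l U(2)] \<open>e > 0\<close>
    by (simp add: continuous_at tendsto_iff eventually_at_filter)
  with eventually_nhds_in_open[OF U] have "\<forall>\<^sub>F y in nhds x. y \<in> U \<and> dist (l y) (l x) < e"
    by eventually_elim (use \<open>e > 0\<close> in fastforce)
  then obtain d where d: "d > 0" "\<And>y. dist y x < d \<Longrightarrow> y \<in> U \<and> dist (l y) (l x) < e"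
    unfolding eventually_nhds_metric by blast
  define \<delta> where "\<delta> = d / (norm u + norm v + 1)"
  have pos: "norm u + norm v + 1 > 0" by (smt (verit) norm_ge_zero)
  have \<delta>: "\<delta> > 0" using d(1) pos by (simp add: \<delta>_def)
  have near: "dist (x + s *\<^sub>R u + t *\<^sub>R v) x < d" if "0 \<le> s" "s < \<delta>" "0 \<le> t" "t < \<delta>" for s t
  proof -
    have "dist (x + s *\<^sub>R u + t *\<^sub>R v) x \<le> s * norm u + t * norm v"
      using that norm_triangle_ineq[of "s *\<^sub>R u" "t *\<^sub>R v"] by (simp add: dist_norm)
    also have "\<dots> \<le> \<delta> * norm u + \<delta> * norm v"
      using that by (intro add_mono mult_right_mono) auto
    also have "\<dots> < \<delta> * (norm u + norm v + 1)" using \<delta> by (simp add: algebra_simps)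
    also have "\<dots> = d" using pos by (simp add: \<delta>_def)
    finally show ?thesis .
  qed
  have main: "dist ((h (x + \<tau> *\<^sub>R u + \<tau> *\<^sub>R v) - h (x + \<tau> *\<^sub>R u) - h (x + \<tau> *\<^sub>R v) + h x) / \<tau>\<^sup>2) (l x) < e"
    if \<tau>: "0 < \<tau>" "\<tau> < \<delta>" for \<tau>
  proof -
    \<comment> \<open>the increment in direction \<open>v\<close>, viewed as a function along \<open>u\<close>; the term \<open>0 *\<^sub>R v\<close> lets
      both summands share one derivative formula\<close>
    define \<phi> where "\<phi> = (\<lambda>s. h (x + s *\<^sub>R u + \<tau> *\<^sub>R v) - h (x + s *\<^sub>R u + 0 *\<^sub>R v))"
    have hd: "((\<lambda>s. h (x + s *\<^sub>R u + t *\<^sub>R v)) has_field_derivative k (x + s *\<^sub>R u + t *\<^sub>R v)) (at s)"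
      if "0 \<le> s" "s < \<delta>" "0 \<le> t" "t < \<delta>" for s t
    proof -
      let ?p = "x + s *\<^sub>R u + t *\<^sub>R v"
      have in_U: "?p \<in> U" using d(2) near[OF that] by blast
      have "((\<lambda>s. x + s *\<^sub>R u + t *\<^sub>R v) has_derivative (\<lambda>r. r *\<^sub>R u)) (at s)"
        by (auto intro!: derivative_eq_intros)
      from has_derivative_compose[OF this smooth_open_has_derivative[OF h in_U]]
      show ?thesis
        using linear_scale[OF has_derivative_linear[OF smooth_open_has_derivative[OF h in_U]]]
        by (simp add: has_field_derivative_def k_def mult.commute[of "frechet_derivative _ _ _"]
            fun_eq_iff mult_commute_abs)
    qed
    have "\<exists>z. 0 < z \<and> z < \<tau> \<and> \<phi> \<tau> - \<phi> 0 =
        (\<tau> - 0) * (k (x + z *\<^sub>R u + \<tau> *\<^sub>R v) - k (x + z *\<^sub>R u + 0 *\<^sub>R v))"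
    proof (rule MVT2[OF \<tau>(1)])
      fix s assume "0 \<le> s" "s \<le> \<tau>"
      then show "(\<phi> has_field_derivative (k (x + s *\<^sub>R u + \<tau> *\<^sub>R v) - k (x + s *\<^sub>R u + 0 *\<^sub>R v))) (at s)"
        unfolding \<phi>_def using \<tau> by (intro DERIV_diff hd) auto
    qed
    then obtain z where z: "0 < z" "z < \<tau>" "\<phi> \<tau> - \<phi> 0 =
        \<tau> * (k (x + z *\<^sub>R u + \<tau> *\<^sub>R v) - k (x + z *\<^sub>R u + 0 *\<^sub>R v))" by auto
    have kd: "((\<lambda>t. k (x + z *\<^sub>R u + t *\<^sub>R v)) has_field_derivative l (x + z *\<^sub>R u + t *\<^sub>R v)) (at t)"
      if "0 \<le> t" "t \<le> \<tau>" for t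
    proof -
      let ?p = "x + z *\<^sub>R u + t *\<^sub>R v"
      have in_U: "?p \<in> U" using d(2) near[of z t] z that \<tau> by simp
      have "((\<lambda>t. x + z *\<^sub>R u + t *\<^sub>R v) has_derivative (\<lambda>r. r *\<^sub>R v)) (at t)"
        by (auto intro!: derivative_eq_intros)
      from has_derivative_compose[OF this smooth_open_has_derivative[OF k in_U]]
      show ?thesis
        using linear_scale[OF has_derivative_linear[OF smooth_open_has_derivative[OF k in_U]]]
        by (simp add: has_field_derivative_def l_def mult_commute_abs)
    qed
    have "\<exists>w. 0 < w \<and> w < \<tau> \<and> k (x + z *\<^sub>R u + \<tau> *\<^sub>R v) - k (x + z *\<^sub>R u + 0 *\<^sub>R v) =
        (\<tau> - 0) * l (x + z *\<^sub>R u + w *\<^sub>R v)"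
      by (rule MVT2[OF \<tau>(1) kd])
    then obtain w where w: "0 < w" "w < \<tau>"
      "k (x + z *\<^sub>R u + \<tau> *\<^sub>R v) - k (x + z *\<^sub>R u + 0 *\<^sub>R v) = \<tau> * l (x + z *\<^sub>R u + w *\<^sub>R v)"
      by auto
    have "h (x + \<tau> *\<^sub>R u + \<tau> *\<^sub>R v) - h (x + \<tau> *\<^sub>R u) - h (x + \<tau> *\<^sub>R v) + h x = \<phi> \<tau> - \<phi> 0"
      by (simp add: \<phi>_def)
    also have "\<dots> = \<tau>\<^sup>2 * l (x + z *\<^sub>R u + w *\<^sub>R v)"
      using z(3) w(3) by (simp add: power2_eq_square)
    finally have "(h (x + \<tau> *\<^sub>R u + \<tau> *\<^sub>R v) - h (x + \<tau> *\<^sub>R u) - h (x + \<tau> *\<^sub>R v) + h x) / \<tau>\<^sup>2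
        = l (x + z *\<^sub>R u + w *\<^sub>R v)"
      using \<tau> by simp
    then show ?thesis
      using d(2) near[of z w] z w \<tau> by simp
  qed
  have lx: "frechet_derivative (\<lambda>y. frechet_derivative h (at y) u) (at x) v = l x"
    by (simp add: l_def k_def)
  show "\<forall>\<^sub>F \<tau> in at_right 0. dist ((h (x + \<tau> *\<^sub>R u + \<tau> *\<^sub>R v) - h (x + \<tau> *\<^sub>R u) -
      h (x + \<tau> *\<^sub>R v) + h x) / \<tau>\<^sup>2) (frechet_derivative (\<lambda>y. frechet_derivative h (at y) u) (at x) v) < e"
    unfolding lx eventually_at_right_field by (intro exI[of _ \<delta>] conjI \<delta> allI impI main)
qed

lemma second_derivative_symmetric:
  fixes h :: "'a::euclidean_space \<Rightarrow> real"
  assumes "open U" "x \<in> U" "smooth_open U h"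
  shows "frechet_derivative (\<lambda>y. frechet_derivative h (at y) u) (at x) v =
    frechet_derivative (\<lambda>y. frechet_derivative h (at y) v) (at x) u"
proof (rule tendsto_unique[OF _ second_difference_limit[OF assms]])
  show "((\<lambda>\<tau>. (h (x + \<tau> *\<^sub>R u + \<tau> *\<^sub>R v) - h (x + \<tau> *\<^sub>R u) - h (x + \<tau> *\<^sub>R v) + h x) / \<tau>\<^sup>2)
     \<longlongrightarrow> frechet_derivative (\<lambda>y. frechet_derivative h (at y) v) (at x) u) (at_right 0)"
    using second_difference_limit[OF assms, of v u] by (simp add: algebra_simps)
qed simp

section \<open>The Levi-Civita connection of a submanifold with a smooth projection\<close>

lemma smooth_subE:
  assumes "smooth_sub S f" "x \<in> S"
  obtains U h where "open U" "x \<in> U" "smooth_open U h" "\<And>y. y \<in> S \<Longrightarrow> y \<in> U \<Longrightarrow> h y = f y"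
proof -
  obtain U h where "open U" "x \<in> U" "smooth_open U h" "\<forall>y\<in>S \<inter> U. h y = f y"
    using assms unfolding smooth_sub_def by meson
  then show thesis using that[of U h] by auto
qed

lemma smooth_subI:
  assumes "\<And>x. x \<in> S \<Longrightarrow>
    \<exists>U h. open U \<and> x \<in> U \<and> smooth_open U h \<and> (\<forall>y\<in>S \<inter> U. h y = f y)"
  shows "smooth_sub S f"
  unfolding smooth_sub_def by (intro ballI assms)

lemma smooth_sub_extension:
  assumes "smooth_open UNIV h" "\<And>y. y \<in> S \<Longrightarrow> h y = f y"
  shows "smooth_sub S f"
proof (rule smooth_subI)
  show "\<exists>U h. open U \<and> x \<in> U \<and> smooth_open U h \<and> (\<forall>y\<in>S \<inter> U. h y = f y)" for x
    by (rule exI[of _ UNIV], rule exI[of _ h]) (simp add: assms)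
qed

lemma smooth_sub_common:
  assumes "smooth_sub S f" "smooth_sub S g" "x \<in> S"
  obtains U h k where "open U" "x \<in> U" "smooth_open U h" "smooth_open U k"
    "\<And>y. y \<in> S \<Longrightarrow> y \<in> U \<Longrightarrow> h y = f y" "\<And>y. y \<in> S \<Longrightarrow> y \<in> U \<Longrightarrow> k y = g y"
proof -
  obtain U h where h: "open U" "x \<in> U" "smooth_open U h" "\<And>y. y \<in> S \<Longrightarrow> y \<in> U \<Longrightarrow> h y = f y"
    using smooth_subE[OF assms(1,3)] by metis
  obtain W k where k: "open W" "x \<in> W" "smooth_open W k" "\<And>y. y \<in> S \<Longrightarrow> y \<in> W \<Longrightarrow> k y = g y"
    using smooth_subE[OF assms(2,3)] by metis
  show thesis
  proof (rule that)
    show "open (U \<inter> W)" using h(1) k(1) by (rule open_Int)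
    show "x \<in> U \<inter> W" using h(2) k(2) by (rule IntI)
    show "smooth_open (U \<inter> W) h" by (rule smooth_open_subset[OF h(3) Int_lower1])
    show "smooth_open (U \<inter> W) k" by (rule smooth_open_subset[OF k(3) Int_lower2])
    show "h y = f y" if "y \<in> S" "y \<in> U \<inter> W" for y using h(4) that by blast
    show "k y = g y" if "y \<in> S" "y \<in> U \<inter> W" for y using k(4) that by blast
  qed
qed

text \<open>This records what an embedded submanifold provides: tangent vectors are velocities of curves
  in \<open>S\<close> (so derivatives within \<open>S\<close> are determined on them), vectors annihilating all functions that
  vanish on \<open>S\<close> are tangent (so \<open>T x\<close> is not too small), and the orthogonal projections \<open>P x\<close> extend
  smoothly to the ambient space. The metric is the restriction of the constant form \<open>m\<close>.\<close>

locale projected_submanifold =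
  fixes S :: "'a::euclidean_space set" and T :: "'a \<Rightarrow> 'a set"
    and m :: "'a \<Rightarrow> 'a \<Rightarrow> real" and P :: "'a \<Rightarrow> 'a \<Rightarrow> 'a"
  assumes m_bilinear: "bounded_bilinear m"
    and m_sym: "m u v = m v u"
    and m_pos: "u \<noteq> 0 \<Longrightarrow> 0 < m u u"
    and tangent_curve: "x \<in> S \<Longrightarrow> v \<in> T x \<Longrightarrow>
      \<exists>\<gamma>::real \<Rightarrow> 'a. \<gamma> 0 = x \<and> (\<forall>t. \<gamma> t \<in> S) \<and> (\<gamma> has_vector_derivative v) (at 0)"
    and tangentI: "x \<in> S \<Longrightarrow>
      (\<And>h::'a \<Rightarrow> real. smooth_open UNIV h \<Longrightarrow> (\<And>y. y \<in> S \<Longrightarrow> h y = 0) \<Longrightarrow>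
        frechet_derivative h (at x) v = 0) \<Longrightarrow> v \<in> T x"
    and P_linear: "linear (P x)"
    and P_smooth: "smooth_open UNIV (\<lambda>x. P x w)"
    and P_tangent: "x \<in> S \<Longrightarrow> P x u \<in> T x"
    and P_orthogonal: "x \<in> S \<Longrightarrow> z \<in> T x \<Longrightarrow> m (u - P x u) z = 0"
begin

sublocale m: bounded_bilinear m by (rule m_bilinear)

text \<open>Composing with a curve of velocity \<open>v\<close> reduces the claim to uniqueness of derivatives on the real
  line.\<close>

lemma within_derivative_unique:
  assumes "x \<in> S" "v \<in> T x"
    and F: "(f has_derivative F) (at x within S)" and G: "(f has_derivative G) (at x within S)"
  shows "F v = G v"
proof -
  obtain \<gamma> :: "real \<Rightarrow> 'a" where \<gamma>: "\<gamma> 0 = x" "\<And>t. \<gamma> t \<in> S" "(\<gamma> has_vector_derivative v) (at 0)"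
    using tangent_curve[OF assms(1,2)] by blast
  have *: "((\<lambda>t. f (\<gamma> t)) has_derivative (\<lambda>t. H (t *\<^sub>R v))) (at 0)"
    if "(f has_derivative H) (at x within S)" for H
  proof (rule has_derivative_in_compose[of \<gamma> "\<lambda>t. t *\<^sub>R v"])
    show "(\<gamma> has_derivative (\<lambda>t. t *\<^sub>R v)) (at 0)"
      using \<gamma>(3) by (simp add: has_vector_derivative_def)
    show "(f has_derivative H) (at (\<gamma> 0) within range \<gamma>)"
      using that \<gamma>(1,2) by (auto intro: has_derivative_subset)
  qed
  have "(\<lambda>t::real. F (t *\<^sub>R v)) = (\<lambda>t. G (t *\<^sub>R v))"
    by (rule has_derivative_unique[OF *[OF F] *[OF G]])
  from fun_cong[OF this, of 1] show ?thesis by simp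
qed

lemma differential_extension:
  assumes "x \<in> S" "v \<in> T x" and U: "open U" "x \<in> U" and h: "smooth_open U h"
    and eq: "\<And>y. y \<in> S \<Longrightarrow> y \<in> U \<Longrightarrow> h y = f y"
  shows "differential S f x v = frechet_derivative h (at x) v"
proof -
  obtain d where d: "d > 0" "ball x d \<subseteq> U" using U open_contains_ball by blast
  have "(f has_derivative frechet_derivative h (at x)) (at x within S)"
  proof (rule has_derivative_transform_within[OF _ d(1) assms(1)])
    show "(h has_derivative frechet_derivative h (at x)) (at x within S)"
      by (rule has_derivative_at_withinI[OF smooth_open_has_derivative[OF h U(2)]])
    show "h y = f y" if "y \<in> S" "dist y x < d" for y
      using that d(2) eq by (auto simp: subset_iff dist_commute)
  qed
  moreover from this have "(f has_derivative frechet_derivative f (at x within S)) (at x within S)"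
    using frechet_derivative_works differentiable_def by blast
  ultimately show ?thesis
    unfolding differential_def using within_derivative_unique[OF assms(1,2)] by blast
qed

lemma linear_frechet_smooth:
  "smooth_open U h \<Longrightarrow> x \<in> U \<Longrightarrow> linear (frechet_derivative h (at x))"
  using smooth_open_has_derivative has_derivative_linear by blast

lemma differential_zero_extension:
  assumes "x \<in> S" "v \<in> T x" "open U" "x \<in> U" "smooth_open U h"
    and "\<And>y. y \<in> S \<Longrightarrow> y \<in> U \<Longrightarrow> h y = 0"
  shows "frechet_derivative h (at x) v = 0"
proof -
  have "frechet_derivative h (at x) v = differential S (\<lambda>y. 0) x v"
    by (rule differential_extension[OF assms, symmetric])
  also have "\<dots> = frechet_derivative (\<lambda>y. 0) (at x) v"
    by (rule differential_extension[OF assms(1-4) smooth_open_const]) simp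
  finally show ?thesis by simp
qed

lemma tangent_iff:
  assumes "x \<in> S"
  shows "v \<in> T x \<longleftrightarrow> (\<forall>h::'a \<Rightarrow> real. smooth_open UNIV h \<longrightarrow> (\<forall>y\<in>S. h y = 0) \<longrightarrow>
    frechet_derivative h (at x) v = 0)"
  using tangentI[OF assms] differential_zero_extension[OF assms _ open_UNIV UNIV_I] by blast

lemma T_subspace:
  assumes "x \<in> S"
  shows "subspace (T x)"
proof -
  have lin: "linear (frechet_derivative h (at x))" if "smooth_open UNIV h" for h :: "'a \<Rightarrow> real"
    using linear_frechet_smooth[OF that] by simp
  show ?thesis
    by (rule subspaceI) (auto simp: tangent_iff[OF assms] lin linear_0 linear_add linear_scale)
qed

lemma m_eq_0: "m u u = 0 \<Longrightarrow> u = 0"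
  using m_pos[of u] by force

lemma P_unique:
  assumes "x \<in> S" "p \<in> T x" "\<And>z. z \<in> T x \<Longrightarrow> m (u - p) z = 0"
  shows "P x u = p"
proof -
  let ?z = "P x u - p"
  have z: "?z \<in> T x" using T_subspace assms(1,2) P_tangent by (blast intro: subspace_diff)
  have "m ?z ?z = m (u - p) ?z - m (u - P x u) ?z" by (simp add: m.diff_left)
  also have "\<dots> = 0" using assms(3)[OF z] P_orthogonal[OF assms(1) z] by simp
  finally show ?thesis using m_eq_0[of ?z] by simp
qed

lemma P_id: "x \<in> S \<Longrightarrow> v \<in> T x \<Longrightarrow> P x v = v"
  by (rule P_unique[of x v v]) (simp_all add: m.zero_left)

lemma m_P: "x \<in> S \<Longrightarrow> z \<in> T x \<Longrightarrow> m (P x u) z = m u z"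
  using P_orthogonal[of x z u] by (simp add: m.diff_left)

lemma smooth_open_P:
  assumes "open U" "smooth_open U w"
  shows "smooth_open U (\<lambda>x. P x (w x))"
  by (rule smooth_open_linear_apply[OF assms(1) P_linear
        smooth_open_subset[OF P_smooth subset_UNIV] assms(2)])

text \<open>Projecting a constant field shows in particular that every tangent vector extends to a vector
  field.\<close>

lemma P_vector_field: "smooth_open UNIV w \<Longrightarrow> (\<lambda>x. P x (w x)) \<in> vector_fields S T"
  using P_tangent smooth_sub_extension[OF smooth_open_P] by (simp add: vector_fields_def)

lemma vector_fieldD: "V \<in> vector_fields S T \<Longrightarrow> x \<in> S \<Longrightarrow> V x \<in> T x"
  "V \<in> vector_fields S T \<Longrightarrow> smooth_sub S V"
  by (auto simp: vector_fields_def)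

text \<open>The Gauss formula: for a constant ambient metric this is the Levi-Civita connection.\<close>

definition projected_derivative :: "('a \<Rightarrow> 'a) \<Rightarrow> ('a \<Rightarrow> 'a) \<Rightarrow> 'a \<Rightarrow> 'a" where
  "projected_derivative U V x = P x (differential S V x (U x))"

text \<open>For \<open>h\<close> vanishing on \<open>S\<close> and a tangent field \<open>W\<close>, the function \<open>y \<mapsto> Dh(y)(W y)\<close> vanishes on \<open>S\<close>.
  Its derivative along a tangent vector \<open>z\<close> gives \<open>Dh(DW z) = - D\<^sup>2h(W, z)\<close>. By symmetry of \<open>D\<^sup>2h\<close> the
  two terms of the bracket contribute equally.\<close>

lemma bracket_tangent:
  assumes U: "U \<in> vector_fields S T" and V: "V \<in> vector_fields S T" and x: "x \<in> S"
  shows "differential S V x (U x) - differential S U x (V x) \<in> T x"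
proof (rule tangentI[OF x])
  fix h :: "'a \<Rightarrow> real" assume h: "smooth_open UNIV h" and h0: "\<And>y. y \<in> S \<Longrightarrow> h y = 0"
  obtain N u v where N: "open N" "x \<in> N" and u: "smooth_open N u" "\<And>y. y \<in> S \<Longrightarrow> y \<in> N \<Longrightarrow> u y = U y"
    and v: "smooth_open N v" "\<And>y. y \<in> S \<Longrightarrow> y \<in> N \<Longrightarrow> v y = V y"
    using smooth_sub_common[OF vector_fieldD(2)[OF U] vector_fieldD(2)[OF V] x] by metis
  have hN: "smooth_open N h" by (rule smooth_open_subset[OF h subset_UNIV])
  have key: "frechet_derivative h (at x) (frechet_derivative w (at x) z) =
      - frechet_derivative (\<lambda>y. frechet_derivative h (at y) (w x)) (at x) z"
    if w: "smooth_open N w" "\<And>y. y \<in> S \<Longrightarrow> y \<in> N \<Longrightarrow> w y \<in> T y" and z: "z \<in> T x" for w z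
  proof -
    have "frechet_derivative (\<lambda>y. frechet_derivative h (at y) (w y)) (at x) z = 0"
    proof (rule differential_zero_extension[OF x z N smooth_open_frechet_field[OF N(1) hN w(1)]])
      show "frechet_derivative h (at y) (w y) = 0" if "y \<in> S" "y \<in> N" for y
        using w(2)[OF that] tangent_iff[OF that(1)] h h0 by blast
    qed
    then show ?thesis
      by (simp add: has_derivative_imp_frechet[OF frechet_field_has_derivative[OF N hN w(1)]])
  qed
  have ux: "u x = U x" and vx: "v x = V x" using u(2) v(2) x N(2) by auto
  have Ux: "U x \<in> T x" and Vx: "V x \<in> T x" using U V x by (auto dest: vector_fieldD)
  have dV: "differential S V x (U x) = frechet_derivative v (at x) (U x)"
    by (rule differential_extension[OF x Ux N v])
  have dU: "differential S U x (V x) = frechet_derivative u (at x) (V x)"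
    by (rule differential_extension[OF x Vx N u])
  have "frechet_derivative h (at x) (frechet_derivative v (at x) (U x)) =
      - frechet_derivative (\<lambda>y. frechet_derivative h (at y) (V x)) (at x) (U x)"
    using key[OF v(1) _ Ux] v(2) V vx by (auto dest: vector_fieldD)
  moreover have "frechet_derivative h (at x) (frechet_derivative u (at x) (V x)) =
      - frechet_derivative (\<lambda>y. frechet_derivative h (at y) (U x)) (at x) (V x)"
    using key[OF u(1) _ Vx] u(2) U ux by (auto dest: vector_fieldD)
  ultimately show "frechet_derivative h (at x) (differential S V x (U x) - differential S U x (V x)) = 0"
    using second_derivative_symmetric[OF N hN, of "U x" "V x"]
    by (simp add: dU dV linear_diff[OF linear_frechet_smooth[OF h UNIV_I]])
qed

lemma projected_derivative_vector_field:
  assumes U: "U \<in> vector_fields S T" and V: "V \<in> vector_fields S T"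
  shows "projected_derivative U V \<in> vector_fields S T"
proof -
  have "smooth_sub S (projected_derivative U V)"
  proof (rule smooth_subI)
    fix x assume x: "x \<in> S"
    obtain N u v where N: "open N" "x \<in> N" and u: "smooth_open N u" "\<And>y. y \<in> S \<Longrightarrow> y \<in> N \<Longrightarrow> u y = U y"
      and v: "smooth_open N v" "\<And>y. y \<in> S \<Longrightarrow> y \<in> N \<Longrightarrow> v y = V y"
      using smooth_sub_common[OF vector_fieldD(2)[OF U] vector_fieldD(2)[OF V] x] by metis
    have "P y (frechet_derivative v (at y) (u y)) = projected_derivative U V y" if "y \<in> S \<inter> N" for y
      using that u(2) differential_extension[OF _ vector_fieldD(1)[OF U] N(1) _ v]
      by (simp add: projected_derivative_def)
    moreover have "smooth_open N (\<lambda>y. P y (frechet_derivative v (at y) (u y)))"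
      by (rule smooth_open_P[OF N(1) smooth_open_frechet_field[OF N(1) v(1) u(1)]])
    ultimately show "\<exists>N h. open N \<and> x \<in> N \<and> smooth_open N h \<and>
        (\<forall>y\<in>S \<inter> N. h y = projected_derivative U V y)"
      using N by blast
  qed
  then show ?thesis
    by (simp add: vector_fields_def projected_derivative_def P_tangent)
qed

text \<open>Derivatives within \<open>S\<close> are computed with local smooth extensions. The Leibniz rule uses
  \<open>P x (V x) = V x\<close>.\<close>

lemma affine_projected_derivative: "affine_connection S T projected_derivative"
  unfolding affine_connection_def
proof (intro conjI ballI allI impI)
  fix U V W :: "'a \<Rightarrow> 'a" and a b :: "'a \<Rightarrow> real" and x
  assume U: "U \<in> vector_fields S T" and V: "V \<in> vector_fields S T"
  show "projected_derivative U V \<in> vector_fields S T"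
    by (rule projected_derivative_vector_field[OF U V])
  assume x: "x \<in> S"
  note PL = linear_add[OF P_linear] linear_scale[OF P_linear]
  have Ux: "U x \<in> T x" and Vx: "V x \<in> T x" using U V x by (auto dest: vector_fieldD)
  {
    assume W: "W \<in> vector_fields S T"
    have Wx: "W x \<in> T x" using W x by (auto dest: vector_fieldD)
    obtain N v where N: "open N" "x \<in> N" and v: "smooth_open N v" "\<And>y. y \<in> S \<Longrightarrow> y \<in> N \<Longrightarrow> v y = V y"
      using smooth_subE[OF vector_fieldD(2)[OF V] x] by metis
    have dV: "differential S V x z = frechet_derivative v (at x) z" if "z \<in> T x" for z
      by (rule differential_extension[OF x that N v])
    have comb: "a x *\<^sub>R U x + b x *\<^sub>R W x \<in> T x"
      using T_subspace[OF x] Ux Wx by (simp add: subspace_add subspace_scale)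
    show "projected_derivative (\<lambda>y. a y *\<^sub>R U y + b y *\<^sub>R W y) V x =
        a x *\<^sub>R projected_derivative U V x + b x *\<^sub>R projected_derivative W V x"
      unfolding projected_derivative_def dV[OF comb] dV[OF Ux] dV[OF Wx]
      by (simp add: PL linear_add[OF linear_frechet_smooth[OF v(1) N(2)]]
          linear_scale[OF linear_frechet_smooth[OF v(1) N(2)]])
  }
  {
    assume W: "W \<in> vector_fields S T"
    obtain N v w where N: "open N" "x \<in> N" and v: "smooth_open N v" "\<And>y. y \<in> S \<Longrightarrow> y \<in> N \<Longrightarrow> v y = V y"
      and w: "smooth_open N w" "\<And>y. y \<in> S \<Longrightarrow> y \<in> N \<Longrightarrow> w y = W y"
      using smooth_sub_common[OF vector_fieldD(2)[OF V] vector_fieldD(2)[OF W] x] by metis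
    have "differential S (\<lambda>y. V y + W y) x (U x) = frechet_derivative (\<lambda>y. v y + w y) (at x) (U x)"
      by (rule differential_extension[OF x Ux N smooth_open_add[OF N(1) v(1) w(1)]]) (simp add: v w)
    also have "\<dots> = frechet_derivative v (at x) (U x) + frechet_derivative w (at x) (U x)"
      by (simp add: has_derivative_imp_frechet[OF has_derivative_add[OF
          smooth_open_has_derivative[OF v(1) N(2)] smooth_open_has_derivative[OF w(1) N(2)]]])
    also have "\<dots> = differential S V x (U x) + differential S W x (U x)"
      by (simp add: differential_extension[OF x Ux N v] differential_extension[OF x Ux N w])
    finally show "projected_derivative U (\<lambda>y. V y + W y) x =
        projected_derivative U V x + projected_derivative U W x"
      by (simp add: projected_derivative_def PL)
  }
  {
    assume a: "smooth_sub S a"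
    obtain N v c where N: "open N" "x \<in> N" and v: "smooth_open N v" "\<And>y. y \<in> S \<Longrightarrow> y \<in> N \<Longrightarrow> v y = V y"
      and c: "smooth_open N c" "\<And>y. y \<in> S \<Longrightarrow> y \<in> N \<Longrightarrow> c y = a y"
      using smooth_sub_common[OF vector_fieldD(2)[OF V] a x] by metis
    have "differential S (\<lambda>y. a y *\<^sub>R V y) x (U x) = frechet_derivative (\<lambda>y. c y *\<^sub>R v y) (at x) (U x)"
      by (rule differential_extension[OF x Ux N
            smooth_open_bilinear[OF N(1) bounded_bilinear_scaleR c(1) v(1)]]) (simp add: v c)
    also have "\<dots> = c x *\<^sub>R frechet_derivative v (at x) (U x) + frechet_derivative c (at x) (U x) *\<^sub>R v x"
      by (simp add: has_derivative_imp_frechet[OF has_derivative_scaleR[OF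
          smooth_open_has_derivative[OF c(1) N(2)] smooth_open_has_derivative[OF v(1) N(2)]]])
    also have "\<dots> = a x *\<^sub>R differential S V x (U x) + differential S a x (U x) *\<^sub>R V x"
      using c(2)[OF x N(2)] v(2)[OF x N(2)]
      by (simp add: differential_extension[OF x Ux N v] differential_extension[OF x Ux N c])
    finally show "projected_derivative U (\<lambda>y. a y *\<^sub>R V y) x =
        differential S a x (U x) *\<^sub>R V x + a x *\<^sub>R projected_derivative U V x"
      by (simp add: projected_derivative_def PL P_id[OF x Vx])
  }
qed

text \<open>The bracket is tangent, so the projection leaves it unchanged. In the iterated derivatives of
  \<open>h\<close> the second-order terms cancel by symmetry.\<close>

lemma torsion_free_projected_derivative: "torsion_free S T projected_derivative"
  unfolding torsion_free_def
proof (intro ballI allI impI)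
  fix U V :: "'a \<Rightarrow> 'a" and h :: "'a \<Rightarrow> real" and x
  assume U: "U \<in> vector_fields S T" and V: "V \<in> vector_fields S T" and h: "smooth_sub S h"
    and x: "x \<in> S"
  obtain N1 u v where N1: "open N1" "x \<in> N1" and u1: "smooth_open N1 u" "\<And>y. y \<in> S \<Longrightarrow> y \<in> N1 \<Longrightarrow> u y = U y"
    and v1: "smooth_open N1 v" "\<And>y. y \<in> S \<Longrightarrow> y \<in> N1 \<Longrightarrow> v y = V y"
    using smooth_sub_common[OF vector_fieldD(2)[OF U] vector_fieldD(2)[OF V] x] by metis
  obtain N2 k where N2: "open N2" "x \<in> N2" and k2: "smooth_open N2 k" "\<And>y. y \<in> S \<Longrightarrow> y \<in> N2 \<Longrightarrow> k y = h y"
    using smooth_subE[OF h x] by metis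
  define N where "N = N1 \<inter> N2"
  have N: "open N" "x \<in> N" using N1 N2 by (auto simp: N_def)
  have u: "smooth_open N u" "\<And>y. y \<in> S \<Longrightarrow> y \<in> N \<Longrightarrow> u y = U y"
    using u1 smooth_open_subset[of N1 u N] by (auto simp: N_def)
  have v: "smooth_open N v" "\<And>y. y \<in> S \<Longrightarrow> y \<in> N \<Longrightarrow> v y = V y"
    using v1 smooth_open_subset[of N1 v N] by (auto simp: N_def)
  have k: "smooth_open N k" "\<And>y. y \<in> S \<Longrightarrow> y \<in> N \<Longrightarrow> k y = h y"
    using k2 smooth_open_subset[of N2 k N] by (auto simp: N_def)
  have Ux: "U x \<in> T x" and Vx: "V x \<in> T x" using U V x by (auto dest: vector_fieldD)
  have ux: "u x = U x" and vx: "v x = V x" using u(2) v(2) x N(2) by auto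
  have second: "differential S (\<lambda>y. differential S h y (Z y)) x e =
      frechet_derivative k (at x) (differential S Z x e) +
      frechet_derivative (\<lambda>y. frechet_derivative k (at y) (Z x)) (at x) e"
    if Z: "Z \<in> vector_fields S T" and z: "smooth_open N z" "\<And>y. y \<in> S \<Longrightarrow> y \<in> N \<Longrightarrow> z y = Z y"
      and e: "e \<in> T x" for Z z e
  proof -
    have "differential S (\<lambda>y. differential S h y (Z y)) x e =
        frechet_derivative (\<lambda>y. frechet_derivative k (at y) (z y)) (at x) e"
    proof (rule differential_extension[OF x e N smooth_open_frechet_field[OF N(1) k(1) z(1)]])
      show "frechet_derivative k (at y) (z y) = differential S h y (Z y)" if "y \<in> S" "y \<in> N" for y
        using differential_extension[OF that(1) vector_fieldD(1)[OF Z that(1)] N(1) that(2) k] z(2)[OF that]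
        by simp
    qed
    also have "\<dots> = frechet_derivative k (at x) (frechet_derivative z (at x) e) +
      frechet_derivative (\<lambda>y. frechet_derivative k (at y) (z x)) (at x) e"
      by (simp add: has_derivative_imp_frechet[OF frechet_field_has_derivative[OF N k(1) z(1)]])
    finally show ?thesis
      using z(2)[OF x N(2)] by (simp add: differential_extension[OF x e N z])
  qed
  have "projected_derivative U V x - projected_derivative V U x =
      P x (differential S V x (U x) - differential S U x (V x))"
    by (simp add: projected_derivative_def linear_diff[OF P_linear])
  also have "\<dots> = differential S V x (U x) - differential S U x (V x)"
    by (rule P_id[OF x bracket_tangent[OF U V x]])
  finally have br: "projected_derivative U V x - projected_derivative V U x =
    differential S V x (U x) - differential S U x (V x)" .
  show "differential S h x (projected_derivative U V x - projected_derivative V U x) =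
      differential S (\<lambda>y. differential S h y (V y)) x (U x) -
      differential S (\<lambda>y. differential S h y (U y)) x (V x)"
    using second[OF V v Ux] second[OF U u Vx]
      differential_extension[OF x bracket_tangent[OF U V x] N k]
      second_derivative_symmetric[OF N k(1), of "U x" "V x"] br
      linear_diff[OF linear_frechet_smooth[OF k(1) N(2)], of "differential S V x (U x)" "differential S U x (V x)"]
    by simp
qed

text \<open>The product rule for the constant form \<open>m\<close>; replacing derivatives by their projections does
  not change their products with tangent vectors.\<close>

lemma metric_projected_derivative: "metric_compatible S T (\<lambda>x. m) projected_derivative"
  unfolding metric_compatible_def
proof (intro ballI)
  fix U V W :: "'a \<Rightarrow> 'a" and x
  assume U: "U \<in> vector_fields S T" and V: "V \<in> vector_fields S T" and W: "W \<in> vector_fields S T"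
    and x: "x \<in> S"
  have Ux: "U x \<in> T x" and Vx: "V x \<in> T x" and Wx: "W x \<in> T x"
    using U V W x by (auto dest: vector_fieldD)
  obtain N v w where N: "open N" "x \<in> N" and v: "smooth_open N v" "\<And>y. y \<in> S \<Longrightarrow> y \<in> N \<Longrightarrow> v y = V y"
    and w: "smooth_open N w" "\<And>y. y \<in> S \<Longrightarrow> y \<in> N \<Longrightarrow> w y = W y"
    using smooth_sub_common[OF vector_fieldD(2)[OF V] vector_fieldD(2)[OF W] x] by metis
  have "differential S (\<lambda>y. m (V y) (W y)) x (U x) = frechet_derivative (\<lambda>y. m (v y) (w y)) (at x) (U x)"
    by (rule differential_extension[OF x Ux N smooth_open_bilinear[OF N(1) m_bilinear v(1) w(1)]])
      (simp add: v w)
  also have "\<dots> = m (v x) (frechet_derivative w (at x) (U x)) + m (frechet_derivative v (at x) (U x)) (w x)"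
    by (simp add: has_derivative_imp_frechet[OF m.FDERIV[OF
          smooth_open_has_derivative[OF v(1) N(2)] smooth_open_has_derivative[OF w(1) N(2)]]])
  also have "\<dots> = m (V x) (differential S W x (U x)) + m (differential S V x (U x)) (W x)"
    using v(2)[OF x N(2)] w(2)[OF x N(2)]
    by (simp add: differential_extension[OF x Ux N v] differential_extension[OF x Ux N w])
  finally show "differential S (\<lambda>y. m (V y) (W y)) x (U x) =
      m (projected_derivative U V x) (W x) + m (V x) (projected_derivative U W x)"
    using m_sym[of "V x"] by (simp add: projected_derivative_def m_P[OF x Vx] m_P[OF x Wx])
qed

text \<open>Let \<open>E\<close> be the difference of the two connections. Vanishing torsion, tested on linear functions,
  makes \<open>E\<close> symmetric; metric compatibility makes \<open>m (E U V) W\<close> skew in \<open>V\<close> and \<open>W\<close>. Alternating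
  the two symmetries three times gives \<open>m (E U V) W = - m (E U V) W\<close>. Applied to a field \<open>W\<close> whose
  value at the point is \<open>E U V\<close>, this makes \<open>E U V\<close> vanish there.\<close>

lemma connection_unique:
  assumes D: "affine_connection S T D" "torsion_free S T D" "metric_compatible S T (\<lambda>x. m) D"
    and D': "affine_connection S T D'" "torsion_free S T D'" "metric_compatible S T (\<lambda>x. m) D'"
    and U: "U \<in> vector_fields S T" and V: "V \<in> vector_fields S T" and x: "x \<in> S"
  shows "D U V x = D' U V x"
proof -
  have in_T: "C A B x \<in> T x"
    if "affine_connection S T C" "A \<in> vector_fields S T" "B \<in> vector_fields S T" for C A B
  proof -
    have "C A B \<in> vector_fields S T" using that unfolding affine_connection_def by (elim conjE) blast
    then show ?thesis using x by (rule vector_fieldD)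
  qed
  note DT = in_T[OF D(1)] in_T[OF D'(1)]
  note sub = subspace_diff[OF T_subspace[OF x]]
  define E where "E = (\<lambda>A B. D A B x - D' A B x)"
  have E_sym: "E A B = E B A" if A: "A \<in> vector_fields S T" and B: "B \<in> vector_fields S T" for A B
  proof -
    have "(D A B x - D B A x) \<bullet> b = (D' A B x - D' B A x) \<bullet> b" for b
    proof -
      let ?h = "\<lambda>y. y \<bullet> b"
      have sm: "smooth_open UNIV ?h"
        by (rule smooth_open_bounded_linear[OF open_UNIV bounded_linear_inner_left smooth_open_ident])
      then have "smooth_sub S ?h" by (rule smooth_sub_extension) simp
      note tf = this x
      have "differential S ?h x (D A B x - D B A x) = differential S ?h x (D' A B x - D' B A x)"
        by (rule trans[OF D(2)[unfolded torsion_free_def, rule_format, OF A B tf]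
              D'(2)[unfolded torsion_free_def, rule_format, OF A B tf, symmetric]])
      moreover have "differential S ?h x z = z \<bullet> b" if "z \<in> T x" for z
      proof -
        have "(?h has_derivative ?h) (at x)" by (intro bounded_linear_imp_has_derivative bounded_linear_inner_left)
        from has_derivative_imp_frechet[OF this] show ?thesis
          using differential_extension[OF x that open_UNIV UNIV_I sm, of ?h] by simp
      qed
      ultimately show ?thesis using sub DT A B by simp
    qed
    then have "D A B x - D B A x = D' A B x - D' B A x" by (metis inner_commute vector_eq_rdot)
    then show ?thesis by (simp add: E_def algebra_simps)
  qed
  have E_skew: "m (E A B) (C x) = - m (E A C) (B x)"
    if A: "A \<in> vector_fields S T" and B: "B \<in> vector_fields S T" and C: "C \<in> vector_fields S T" for A B C
  proof -
    have "m (D A B x) (C x) + m (B x) (D A C x) = m (D' A B x) (C x) + m (B x) (D' A C x)"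
      by (rule trans[OF D(3)[unfolded metric_compatible_def, rule_format, OF A B C x, symmetric]
            D'(3)[unfolded metric_compatible_def, rule_format, OF A B C x]])
    then show ?thesis
      unfolding E_def m.diff_left using m_sym[of "B x"] by simp
  qed
  define W where "W = (\<lambda>y. P y (E U V))"
  have W: "W \<in> vector_fields S T" unfolding W_def by (rule P_vector_field[OF smooth_open_const])
  have Wx: "W x = E U V" unfolding W_def using P_id[OF x] sub DT U V by (simp add: E_def)
  have "m (E U V) (W x) = - m (E U V) (W x)"
    using E_skew[OF U V W] E_sym[OF U W] E_skew[OF W U V] E_sym[OF W V] E_skew[OF V W U] E_sym[OF V U]
    by simp
  then have "E U V = 0" using m_eq_0 Wx by simp
  then show ?thesis by (simp add: E_def)
qed

lemma levi_civita_eq: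
  assumes "U \<in> vector_fields S T" "V \<in> vector_fields S T" "x \<in> S"
  shows "levi_civita S T (\<lambda>x. m) U V x = projected_derivative U V x"
proof -
  let ?Q = "\<lambda>D. affine_connection S T D \<and> torsion_free S T D \<and> metric_compatible S T (\<lambda>x. m) D"
  have ex: "?Q projected_derivative"
    using affine_projected_derivative torsion_free_projected_derivative metric_projected_derivative by blast
  have lc: "?Q (levi_civita S T (\<lambda>x. m))"
    unfolding levi_civita_def by (rule someI[of ?Q, OF ex])
  show ?thesis
    by (rule connection_unique[OF _ _ _ _ _ _ assms]) (simp_all only: lc ex)
qed

lemma covariant_derivative_eq:
  assumes x: "x \<in> S" and v: "v \<in> T x" and W: "W \<in> vector_fields S T"
  shows "covariant_derivative S T (\<lambda>x. m) x v W = P x (differential S W x v)"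
  unfolding covariant_derivative_def
proof (rule the_equality)
  show "\<forall>V\<in>vector_fields S T. V x = v \<longrightarrow> levi_civita S T (\<lambda>x. m) V W x = P x (differential S W x v)"
    using levi_civita_eq[OF _ W x] by (simp add: projected_derivative_def)
  have "(\<lambda>y. P y v) \<in> vector_fields S T" by (rule P_vector_field[OF smooth_open_const])
  then show "z = P x (differential S W x v)"
    if "\<forall>V\<in>vector_fields S T. V x = v \<longrightarrow> levi_civita S T (\<lambda>x. m) V W x = z" for z
    using that P_id[OF x v] levi_civita_eq[OF _ W x] by (auto simp: projected_derivative_def)
qed

lemma riemannian_gradient_eq:
  assumes x: "x \<in> S" and h: "smooth_open UNIV h" "\<And>y. y \<in> S \<Longrightarrow> h y = f y"
    and G: "\<And>v. m G v = frechet_derivative h (at x) v"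
  shows "riemannian_gradient S T (\<lambda>x. m) f x = P x G"
  unfolding riemannian_gradient_def
proof (rule the_equality)
  have d: "differential S f x v = m G v" if "v \<in> T x" for v
    using differential_extension[OF x that open_UNIV UNIV_I h] G by simp
  show "P x G \<in> T x \<and> (\<forall>v\<in>T x. m (P x G) v = differential S f x v)"
    using P_tangent[OF x] m_P[OF x] d by simp
  show "A = P x G" if "A \<in> T x \<and> (\<forall>v\<in>T x. m A v = differential S f x v)" for A
    using P_unique[OF x, of A G] that d by (simp add: m.diff_left)
qed

text \<open>On \<open>S\<close> the gradient is the projection of an ambient gradient \<open>G\<close>, which provides the
  smooth extension needed to differentiate it.\<close>

theorem riemannian_hessian_eq:
  assumes x: "x \<in> S" and v: "v \<in> T x" and h: "smooth_open UNIV h" "\<And>y. y \<in> S \<Longrightarrow> h y = f y"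
    and G: "smooth_open UNIV G" "\<And>y v. m (G y) v = frechet_derivative h (at y) v"
  shows "riemannian_hessian S T (\<lambda>x. m) f x v = P x (frechet_derivative (\<lambda>y. P y (G y)) (at x) v)"
proof -
  let ?W = "riemannian_gradient S T (\<lambda>x. m) f"
  have eq: "?W y = P y (G y)" if "y \<in> S" for y
    by (rule riemannian_gradient_eq[OF that h G(2)])
  have sm: "smooth_open UNIV (\<lambda>y. P y (G y))" by (rule smooth_open_P[OF open_UNIV G(1)])
  have "?W \<in> vector_fields S T"
    using smooth_sub_extension[OF sm, of S ?W] by (simp add: vector_fields_def eq P_tangent)
  moreover have "differential S ?W x v = frechet_derivative (\<lambda>y. P y (G y)) (at x) v"
    by (rule differential_extension[OF x v open_UNIV UNIV_I sm]) (simp add: eq)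
  ultimately show ?thesis
    unfolding riemannian_hessian_def by (simp add: covariant_derivative_eq[OF x v])
qed

end

section \<open>Matrices as a Euclidean space\<close>

lemma bounded_bilinear_matrix_mult:
  "bounded_bilinear ((**) :: real^'n^'m \<Rightarrow> real^'p^'n \<Rightarrow> real^'p^'m)"
proof -
  have "bilinear ((**) :: real^'n^'m \<Rightarrow> real^'p^'n \<Rightarrow> real^'p^'m)"
    unfolding bilinear_def
  proof (intro conjI allI)
    show "linear ((**) A)" for A :: "real^'n^'m"
      by (rule linearI) (simp_all add: matrix_add_ldistrib matrix_scalar_ac scalar_matrix_assoc[symmetric])
    show "linear (\<lambda>A. A ** C)" for C :: "real^'p^'n"
      by (rule linearI)
        (simp_all add: matrix_matrix_mult_def vec_eq_iff sum.distrib algebra_simps sum_distrib_left)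
  qed
  then show ?thesis by (simp add: bilinear_conv_bounded_bilinear)
qed

interpretation matrix_mult: bounded_bilinear "(**) :: real^'n^'m \<Rightarrow> real^'p^'n \<Rightarrow> real^'p^'m"
  by (rule bounded_bilinear_matrix_mult)

lemma bounded_linear_transpose: "bounded_linear (transpose :: real^'n^'m \<Rightarrow> real^'m^'n)"
proof -
  have "linear (transpose :: real^'n^'m \<Rightarrow> real^'m^'n)"
    by (rule linearI) (simp_all add: transpose_def vec_eq_iff)
  then show ?thesis by (simp add: linear_conv_bounded_linear)
qed

lemmas linear_transpose = bounded_linear.linear[OF bounded_linear_transpose]
lemmas transpose_add = linear_add[OF linear_transpose]
lemmas transpose_diff = linear_diff[OF linear_transpose]
lemmas transpose_zero = linear_0[OF linear_transpose]

lemmas matrix_distribs = matrix_mult.add_left matrix_mult.add_right matrix_mult.diff_left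
  matrix_mult.diff_right matrix_mult.minus_left matrix_mult.minus_right matrix_mult.zero_left
  matrix_mult.zero_right matrix_mult.scaleR_left matrix_mult.scaleR_right
  transpose_add transpose_diff transpose_zero linear_neg[OF linear_transpose] transpose_scalar

lemma trace_transpose_mult: "trace (transpose U ** V) = U \<bullet> V" for U V :: "real^'p^'d"
proof -
  have "trace (transpose U ** V) = (\<Sum>j\<in>UNIV. \<Sum>i\<in>UNIV. U $ i $ j * V $ i $ j)"
    by (simp add: trace_def matrix_matrix_mult_def transpose_def)
  also have "\<dots> = U \<bullet> V"
    by (subst sum.swap) (simp add: inner_vec_def)
  finally show ?thesis .
qed

lemma inner_transpose: "transpose U \<bullet> transpose V = U \<bullet> V" for U V :: "real^'p^'d"
proof -
  have "transpose U \<bullet> transpose V = (\<Sum>j\<in>UNIV. \<Sum>i\<in>UNIV. U $ i $ j * V $ i $ j)"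
    by (simp add: inner_vec_def transpose_def)
  also have "\<dots> = U \<bullet> V"
    by (subst sum.swap) (simp add: inner_vec_def)
  finally show ?thesis .
qed

lemma inner_mult_left: "(A ** U) \<bullet> V = U \<bullet> (transpose A ** V)"
  for A :: "real^'n^'m" and U :: "real^'p^'n"
  by (simp add: trace_transpose_mult[symmetric] matrix_transpose_mul matrix_mul_assoc)

lemma trace_metric_inner: "trace_metric M U V = U \<bullet> (M ** V)"
  by (simp add: trace_metric_def trace_transpose_mult[symmetric] matrix_mul_assoc)

lemma inner_symmetric_skew:
  fixes A K :: "real^'n^'n"
  assumes "transpose A = A" "transpose K = - K"
  shows "A \<bullet> K = 0"
  using inner_transpose[of A K] assms by simp

text \<open>The form is the sum of the quadratic forms of the columns of \<open>U\<close>.\<close>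

lemma sym_pos_def_inner:
  fixes A :: "real^'n^'n" and U :: "real^'p^'n"
  assumes "sym_pos_def A" "U \<noteq> 0"
  shows "0 < U \<bullet> (A ** U)"
proof -
  have pos: "0 < v \<bullet> (A *v v)" if "v \<noteq> 0" for v
    using assms(1) that by (simp add: sym_pos_def_def)
  then have nonneg: "0 \<le> v \<bullet> (A *v v)" for v by (cases "v = 0") (auto simp: less_imp_le)
  have "U \<bullet> (A ** U) = (\<Sum>i\<in>UNIV. \<Sum>j\<in>UNIV. U $ i $ j * (A *v column j U) $ i)"
    by (simp add: inner_vec_def matrix_matrix_mult_def matrix_vector_mult_def column_def)
  also have "\<dots> = (\<Sum>j\<in>UNIV. column j U \<bullet> (A *v column j U))"
    by (subst sum.swap) (simp add: inner_vec_def column_def)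
  finally have eq: "U \<bullet> (A ** U) = (\<Sum>j\<in>UNIV. column j U \<bullet> (A *v column j U))" .
  obtain i j where "U $ i $ j \<noteq> 0" using assms(2) by (auto simp: vec_eq_iff)
  then have "column j U \<noteq> 0" by (auto simp: column_def vec_eq_iff)
  then show ?thesis
    unfolding eq by (intro sum_pos2[where i = j] pos nonneg) auto
qed

lemma sym_pos_def_inverse:
  assumes "sym_pos_def M"
  shows "M ** matrix_inv M = mat 1" "matrix_inv M ** M = mat 1"
    "transpose (matrix_inv M) = matrix_inv M" "sym_pos_def (matrix_inv M)"
proof -
  have sym: "transpose M = M" and pos: "\<And>v. v \<noteq> 0 \<Longrightarrow> 0 < v \<bullet> (M *v v)"
    using assms by (auto simp: sym_pos_def_def)
  have "v = 0" if "M *v v = 0" for v using pos[of v] that by auto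
  then have "\<exists>A. A ** M = mat 1" using matrix_left_invertible_ker by blast
  then have ex: "\<exists>A. M ** A = mat 1 \<and> A ** M = mat 1"
    using matrix_left_right_inverse by blast
  have "M ** matrix_inv M = mat 1 \<and> matrix_inv M ** M = mat 1"
    unfolding matrix_inv_def by (rule someI_ex[OF ex])
  then show 1: "M ** matrix_inv M = mat 1" "matrix_inv M ** M = mat 1" by auto
  have "transpose (matrix_inv M) = transpose (matrix_inv M) ** (M ** matrix_inv M)"
    by (simp add: 1)
  also have "\<dots> = transpose (M ** matrix_inv M) ** matrix_inv M"
    by (simp add: matrix_transpose_mul sym matrix_mul_assoc)
  also have "\<dots> = matrix_inv M" by (simp add: 1)
  finally show 2: "transpose (matrix_inv M) = matrix_inv M" .
  have "0 < v \<bullet> (matrix_inv M *v v)" if "v \<noteq> 0" for v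
  proof -
    have v: "v = M *v (matrix_inv M *v v)" by (simp add: matrix_vector_mul_assoc 1)
    then have "matrix_inv M *v v \<noteq> 0" using that by (metis matrix_vector_mult_0_right)
    from pos[OF this] show ?thesis using v by (metis inner_commute)
  qed
  then show "sym_pos_def (matrix_inv M)" using 2 by (simp add: sym_pos_def_def)
qed

text \<open>The trace form is the standard inner product, so this is the Riesz representation of the
  derivative.\<close>

lemma euclidean_gradient_eq:
  fixes h :: "real^'p^'d \<Rightarrow> real"
  assumes "(h has_derivative h') (at X)"
  shows "euclidean_gradient h X = (\<Sum>i\<in>Basis. h' i *\<^sub>R i)" "euclidean_gradient h X \<bullet> v = h' v"
proof -
  let ?G = "\<Sum>i\<in>Basis. h' i *\<^sub>R i"
  have G: "?G \<bullet> v = h' v" for v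
    using linear_sum_Basis[OF has_derivative_linear[OF assms], of v]
    by (simp add: inner_sum_left inner_commute[of v] mult.commute)
  show eq: "euclidean_gradient h X = ?G"
    unfolding euclidean_gradient_def trace_transpose_mult
  proof (rule the_equality)
    have "(\<lambda>H. ?G \<bullet> H) = h'" by (rule ext) (rule G)
    with assms show "(h has_derivative (\<lambda>H. ?G \<bullet> H)) (at X)" by (simp only:)
    show "A = ?G" if "(h has_derivative (\<lambda>H. A \<bullet> H)) (at X)" for A
    proof -
      have "h' = (\<lambda>H. A \<bullet> H)" by (rule has_derivative_unique[OF assms that])
      then have "A \<bullet> v = ?G \<bullet> v" for v using G[of v] fun_cong[of h' _ v] by metis
      then show ?thesis using vector_eq_rdot by blast
    qed
  qed
  show "euclidean_gradient h X \<bullet> v = h' v" by (simp add: eq G)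
qed

lemma smooth_euclidean_gradient:
  fixes h :: "real^'p^'d \<Rightarrow> real"
  assumes "smooth_open UNIV h"
  shows "smooth_open UNIV (euclidean_gradient h)"
proof -
  have "smooth_open UNIV (\<lambda>X. \<Sum>i\<in>Basis. frechet_derivative h (at X) i *\<^sub>R i)"
    by (rule smooth_open_sum[OF open_UNIV finite_Basis])
      (rule smooth_open_bounded_linear[OF open_UNIV bounded_linear_scaleR_left smooth_open_frechet[OF assms]])
  moreover have "euclidean_gradient h = (\<lambda>X. \<Sum>i\<in>Basis. frechet_derivative h (at X) i *\<^sub>R i)"
    using euclidean_gradient_eq(1)[OF smooth_open_has_derivative[OF assms UNIV_I]] by blast
  ultimately show ?thesis by simp
qed

section \<open>The Lyapunov equation\<close>

definition sylvester :: "real^'n^'n \<Rightarrow> real^'n^'n \<Rightarrow> real^'n^'n" where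
  "sylvester A W = A ** W + W ** A"

lemma bounded_bilinear_sylvester: "bounded_bilinear sylvester"
proof -
  have "bilinear (sylvester :: real^'n^'n \<Rightarrow> _)"
    unfolding bilinear_def sylvester_def
    by (intro conjI allI linearI) (simp_all add: matrix_distribs algebra_simps)
  then show ?thesis by (simp add: bilinear_conv_bounded_bilinear)
qed

text \<open>Pairing \<open>A W + W A\<close> with \<open>W\<close> gives \<open>W \<bullet> A W + W\<^sup>T \<bullet> A W\<^sup>T\<close>, a sum of two positive terms when
  \<open>W\<close> is nonzero.\<close>

lemma sylvester_inj:
  fixes A W :: "real^'n^'n"
  assumes sym: "transpose A = A" and pos: "\<And>W::real^'n^'n. W \<noteq> 0 \<Longrightarrow> 0 < W \<bullet> (A ** W)"
    and "sylvester A W = 0"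
  shows "W = 0"
proof (rule ccontr)
  assume W: "W \<noteq> 0"
  then have "transpose W \<noteq> 0" by (metis transpose_zero transpose_transpose)
  then have "0 < transpose W \<bullet> (A ** transpose W)" by (rule pos)
  also have "\<dots> = W \<bullet> (W ** A)"
    using inner_transpose[of W "W ** A"] by (simp add: matrix_transpose_mul sym)
  finally have "0 < W \<bullet> sylvester A W"
    using pos[OF W] by (simp add: sylvester_def inner_add_right)
  then show False using assms(3) by simp
qed

section \<open>The generalized Stiefel manifold\<close>

locale stiefel_geometry =
  fixes B M :: "real^'d^'d"
  assumes B: "sym_pos_def B" and M: "sym_pos_def M"
begin

abbreviation "Mi \<equiv> matrix_inv M"

lemma B_sym: "transpose B = B" and M_sym: "transpose M = M"
  using B M by (auto simp: sym_pos_def_def)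

lemmas Mi = sym_pos_def_inverse[OF M]

lemma M_Mi: "M ** (Mi ** Z) = Z" and Mi_M: "Mi ** (M ** Z) = Z" for Z :: "real^'p^'d"
  by (simp_all add: matrix_mul_assoc Mi)

lemmas transposes = matrix_transpose_mul transpose_transpose B_sym M_sym Mi(3)
lemmas mult_assoc = matrix_mul_assoc[symmetric]

text \<open>The first summand is the coefficient of the Lyapunov equation on the manifold; away from the
  manifold it degenerates where \<open>X\<close> loses rank. The second summand vanishes on the manifold and
  repairs this.\<close>

definition gram :: "real^'p^'d \<Rightarrow> real^'p^'p" where
  "gram X = transpose X ** (B ** (Mi ** (B ** X))) +
     transpose (transpose X ** (B ** X) - mat 1) ** (transpose X ** (B ** X) - mat 1)"

lemma gram_sym: "transpose (gram X) = gram X"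
  by (simp add: gram_def transpose_add transposes mult_assoc)

text \<open>If \<open>B X W = 0\<close> then \<open>(X\<^sup>T B X - I) W = - W\<close>, so one of the two squares is always positive.\<close>

lemma gram_pos:
  fixes W :: "real^'q^'p"
  assumes "W \<noteq> 0"
  shows "0 < W \<bullet> (gram X ** W)"
proof -
  let ?Y = "B ** (X ** W)" and ?Z = "(transpose X ** (B ** X) - mat 1) ** W"
  have eq: "W \<bullet> (gram X ** W) = ?Y \<bullet> (Mi ** ?Y) + ?Z \<bullet> ?Z"
  proof -
    have "?Y \<bullet> (Mi ** ?Y) = W \<bullet> (transpose X ** (B ** (Mi ** (B ** X))) ** W)"
      by (simp only: inner_mult_left transposes mult_assoc)
    moreover have "?Z \<bullet> ?Z = W \<bullet>
        (transpose (transpose X ** (B ** X) - mat 1) ** (transpose X ** (B ** X) - mat 1) ** W)"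
      by (simp only: inner_mult_left mult_assoc)
    ultimately show ?thesis
      by (simp only: gram_def matrix_mult.add_left inner_add_right)
  qed
  show ?thesis
  proof (cases "?Y = 0")
    case True
    then have "?Z = - W" by (simp add: matrix_distribs mult_assoc)
    then show ?thesis using True assms eq by (simp add: matrix_distribs)
  next
    case False
    then show ?thesis using eq sym_pos_def_inner[OF Mi(4) False] by (simp add: add_pos_nonneg)
  qed
qed

lemma gram_stiefel: "X \<in> stiefel B \<Longrightarrow> gram X = transpose X ** (B ** (Mi ** (B ** X)))"
  by (simp add: gram_def stiefel_def mult_assoc matrix_distribs)

lemma gram_sylvester_inj: "sylvester (gram X) W = 0 \<Longrightarrow> W = 0"
  by (rule sylvester_inj[OF gram_sym gram_pos])

definition multiplier_rhs :: "real^'p^'d \<Rightarrow> real^'p^'d \<Rightarrow> real^'p^'p" where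
  "multiplier_rhs X U = transpose X ** (B ** U) + transpose U ** (B ** X)"

definition multiplier :: "real^'p^'d \<Rightarrow> real^'p^'d \<Rightarrow> real^'p^'p" where
  "multiplier X U = (THE W. sylvester (gram X) W = multiplier_rhs X U)"

lemma multiplier_ex1: "\<exists>!W. sylvester (gram X) W = R"
proof (rule ex_ex1I)
  have lin: "linear (sylvester (gram X))"
    by (rule bounded_linear.linear[OF bounded_bilinear.bounded_linear_right[OF bounded_bilinear_sylvester]])
  have inj: "inj (sylvester (gram X))"
    using gram_sylvester_inj linear_injective_0[OF lin] by blast
  have "surj (sylvester (gram X))" by (rule linear_inj_imp_surj[OF lin inj])
  then show "\<exists>W. sylvester (gram X) W = R" by (metis surjD)
  show "W = W'" if "sylvester (gram X) W = R" "sylvester (gram X) W' = R" for W W'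
    using injD[OF inj] that by metis
qed

lemma multiplier_eq: "sylvester (gram X) (multiplier X U) = multiplier_rhs X U"
  unfolding multiplier_def by (rule theI'[OF multiplier_ex1])

lemma multiplier_unique: "sylvester (gram X) W = multiplier_rhs X U \<Longrightarrow> multiplier X U = W"
  using multiplier_ex1 multiplier_eq by metis

text \<open>Coefficient and right-hand side are symmetric, so the transpose of the solution is a solution
  as well.\<close>

lemma multiplier_sym: "transpose (multiplier X U) = multiplier X U"
proof (rule multiplier_unique[symmetric])
  have "sylvester (gram X) (transpose (multiplier X U)) =
      transpose (sylvester (gram X) (multiplier X U))"
    by (simp add: sylvester_def transpose_add matrix_transpose_mul gram_sym add.commute)
  also have "\<dots> = multiplier_rhs X U"
    by (simp add: multiplier_eq multiplier_rhs_def transpose_add transposes mult_assoc add.commute)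
  finally show "sylvester (gram X) (transpose (multiplier X U)) = multiplier_rhs X U" .
qed

lemma linear_multiplier: "linear (multiplier X)"
proof (rule linearI)
  note syl = bounded_bilinear.add_right[OF bounded_bilinear_sylvester]
    bounded_bilinear.scaleR_right[OF bounded_bilinear_sylvester]
  show "multiplier X (U + V) = multiplier X U + multiplier X V" for U V
    by (rule multiplier_unique)
      (simp add: syl multiplier_eq multiplier_rhs_def matrix_distribs)
  show "multiplier X (c *\<^sub>R U) = c *\<^sub>R multiplier X U" for c U
    by (rule multiplier_unique)
      (simp add: syl multiplier_eq multiplier_rhs_def matrix_distribs scaleR_add_right)
qed

lemmas smooth_mult = smooth_open_bilinear[OF open_UNIV bounded_bilinear_matrix_mult]
lemmas smooth_transpose = smooth_open_bounded_linear[OF open_UNIV bounded_linear_transpose]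
lemmas smooth_add = smooth_open_add[OF open_UNIV]
lemmas smooth_diff = smooth_open_diff[OF open_UNIV]

lemma smooth_gram: "smooth_open UNIV (gram :: real^'p^'d \<Rightarrow> _)"
  unfolding gram_def[abs_def]
  by (intro smooth_add smooth_mult smooth_transpose smooth_diff smooth_open_const smooth_open_ident)

lemma smooth_multiplier:
  fixes G :: "real^'p^'d \<Rightarrow> real^'p^'d"
  assumes "smooth_open UNIV G"
  shows "smooth_open UNIV (\<lambda>X. multiplier X (G X))"
proof -
  have "smooth_open UNIV (\<lambda>X. multiplier_rhs X (G X))"
    unfolding multiplier_rhs_def
    by (intro smooth_add smooth_mult smooth_transpose smooth_open_const smooth_open_ident assms)
  from smooth_open_solution[OF bounded_bilinear_sylvester open_UNIV gram_sylvester_inj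
      smooth_gram this multiplier_eq]
  show ?thesis .
qed

text \<open>Subtracting the normal vector \<open>M\<^sup>-\<^sup>1 B X W\<close> leaves a tangent vector precisely when \<open>W\<close> solves the
  Lyapunov equation that defines the multiplier.\<close>

definition projection :: "real^'p^'d \<Rightarrow> real^'p^'d \<Rightarrow> real^'p^'d" where
  "projection X U = U - Mi ** (B ** (X ** multiplier X U))"

lemma linear_projection: "linear (projection X)"
  unfolding projection_def
  by (rule linearI) (simp_all add: linear_add[OF linear_multiplier] linear_scale[OF linear_multiplier]
      matrix_distribs scaleR_diff_right)

lemma smooth_projection: "smooth_open UNIV (\<lambda>X. projection X U)"
  unfolding projection_def
  by (intro smooth_diff smooth_mult smooth_multiplier smooth_open_const smooth_open_ident)

lemma stiefelD: "X \<in> stiefel B \<Longrightarrow> transpose X ** (B ** X) = mat 1"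
  by (simp add: stiefel_def mult_assoc)

lemma tangent_iff_assoc: "Z \<in> stiefel_tangent B X \<longleftrightarrow> transpose Z ** (B ** X) + transpose X ** (B ** Z) = 0"
  by (simp add: stiefel_tangent_def mult_assoc)

lemma projection_tangent:
  assumes "X \<in> stiefel B"
  shows "projection X U \<in> stiefel_tangent B X"
proof -
  let ?W = "multiplier X U"
  have "transpose (projection X U) ** (B ** X) + transpose X ** (B ** projection X U) =
      multiplier_rhs X U - sylvester (gram X) ?W"
    by (simp add: projection_def multiplier_rhs_def sylvester_def gram_stiefel[OF assms]
        matrix_distribs transposes multiplier_sym mult_assoc)
  then show ?thesis by (simp add: tangent_iff_assoc multiplier_eq)
qed

text \<open>The inner product equals that of the symmetric matrix \<open>W\<close> with \<open>X\<^sup>T B Z\<close>, which is skew for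
  tangent \<open>Z\<close>.\<close>

lemma normal_orthogonal:
  fixes X Z :: "real^'p^'d"
  assumes "transpose W = W" "Z \<in> stiefel_tangent B X"
  shows "trace_metric M (Mi ** (B ** (X ** W))) Z = 0"
proof -
  have "trace_metric M (Mi ** (B ** (X ** W))) Z = W \<bullet> (transpose X ** (B ** Z))"
    by (simp add: trace_metric_inner inner_mult_left transposes mult_assoc Mi_M)
  also have "\<dots> = 0"
  proof (rule inner_symmetric_skew[OF assms(1)])
    have "transpose (transpose X ** (B ** Z)) = transpose Z ** (B ** X)"
      by (simp add: transposes mult_assoc)
    also have "\<dots> = - (transpose X ** (B ** Z))"
      using assms(2) by (simp add: tangent_iff_assoc add_eq_0_iff2)
    finally show "transpose (transpose X ** (B ** Z)) = - (transpose X ** (B ** Z))" .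
  qed
  finally show ?thesis .
qed

lemma bounded_bilinear_trace_metric: "bounded_bilinear (trace_metric M :: real^'p^'d \<Rightarrow> _)"
proof -
  have "bilinear (trace_metric M :: real^'p^'d \<Rightarrow> _)"
    unfolding bilinear_def trace_metric_inner[abs_def]
    by (intro conjI allI linearI) (simp_all add: matrix_distribs inner_add_left inner_add_right)
  then show ?thesis by (simp add: bilinear_conv_bounded_bilinear)
qed

lemma trace_metric_sym: "trace_metric M U V = trace_metric M V U"
  by (simp add: trace_metric_inner inner_mult_left[of M U V, unfolded M_sym, symmetric] inner_commute)

lemma smooth_constraint: "smooth_open UNIV (\<lambda>Y::real^'p^'d. transpose Y ** (B ** Y) - mat 1)"
  by (intro smooth_mult smooth_transpose smooth_diff smooth_open_const smooth_open_ident)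

lemma constraint_derivative:
  fixes X :: "real^'p^'d"
  shows "((\<lambda>Y. transpose Y ** (B ** Y) - mat 1) has_derivative
    (\<lambda>v. transpose X ** (B ** v) + transpose v ** (B ** X))) (at X)"
proof -
  have 1: "((\<lambda>Y::real^'p^'d. transpose Y) has_derivative transpose) (at X)"
    by (rule bounded_linear_imp_has_derivative[OF bounded_linear_transpose])
  have 2: "((\<lambda>Y::real^'p^'d. B ** Y) has_derivative (**) B) (at X)"
    by (rule bounded_linear_imp_has_derivative[OF matrix_mult.bounded_linear_right])
  show ?thesis
    using has_derivative_diff[OF matrix_mult.FDERIV[OF 1 2] has_derivative_const[of "mat 1"]] by simp
qed

text \<open>It is enough to test with the linear functionals of the constraint \<open>Y\<^sup>T B Y - I\<close>, and among them with
  the one given by the derivative of the constraint along \<open>v\<close>.\<close>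

lemma tangentI_functions:
  fixes X :: "real^'p^'d"
  assumes "\<And>h::real^'p^'d \<Rightarrow> real. smooth_open UNIV h \<Longrightarrow> (\<And>Y. Y \<in> stiefel B \<Longrightarrow> h Y = 0) \<Longrightarrow>
    frechet_derivative h (at X) v = 0"
  shows "v \<in> stiefel_tangent B X"
proof -
  let ?D = "transpose X ** (B ** v) + transpose v ** (B ** X)"
  let ?h = "\<lambda>Y. (transpose Y ** (B ** Y) - mat 1) \<bullet> ?D"
  have "frechet_derivative ?h (at X) v = 0"
  proof (rule assms)
    show "smooth_open UNIV ?h"
      by (rule smooth_open_bounded_linear[OF open_UNIV bounded_linear_inner_left smooth_constraint])
    show "?h Y = 0" if "Y \<in> stiefel B" for Y using stiefelD[OF that] by simp
  qed
  moreover have "frechet_derivative ?h (at X) v = ?D \<bullet> ?D"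
    by (simp add: has_derivative_imp_frechet[OF has_derivative_inner_left[OF constraint_derivative]])
  ultimately show ?thesis by (simp add: tangent_iff_assoc add.commute)
qed

lemma skew_inner:
  fixes K :: "real^'n^'n" and Z :: "real^'q^'n"
  assumes "transpose K = - K"
  shows "(K ** Z) \<bullet> Z = 0"
  using inner_mult_left[of K Z Z] assms by (simp add: matrix_distribs inner_commute)

text \<open>Every tangent vector at \<open>X\<close> is the velocity of an infinitesimal \<open>B\<close>-isometry \<open>K B\<close>.
  For \<open>B = I\<close> the choice of \<open>q\<close> is \<open>(I - X X\<^sup>T / 2) v\<close>.\<close>

lemma tangent_generator:
  assumes X: "X \<in> stiefel B" and v: "v \<in> stiefel_tangent B X"
  obtains K where "transpose K = - K" "K ** (B ** X) = v"
proof -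
  define c where "c = transpose X ** (B ** v)"
  have vBX: "transpose v ** (B ** X) = - c"
    using v by (simp add: tangent_iff_assoc c_def eq_neg_iff_add_eq_0)
  have c: "transpose c = - c"
    by (simp add: c_def transposes mult_assoc vBX[unfolded c_def])
  define q where "q = v - (1/2) *\<^sub>R (X ** c)"
  define K where "K = q ** transpose X - X ** transpose q"
  have "transpose K = - K"
    by (simp add: K_def matrix_distribs transposes)
  moreover have "K ** (B ** X) = v"
  proof -
    have tq: "transpose q ** (B ** X) = - c + (1/2) *\<^sub>R c"
      by (simp add: q_def matrix_distribs transposes mult_assoc vBX c stiefelD[OF X])
    have "K ** (B ** X) = q ** (transpose X ** (B ** X)) - X ** (transpose q ** (B ** X))"
      by (simp add: K_def matrix_distribs mult_assoc)
    also have "\<dots> = q - X ** (- c + (1/2) *\<^sub>R c)" by (simp add: tq stiefelD[OF X])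
    also have "\<dots> = v" by (simp add: q_def matrix_distribs vec_eq_iff)
    finally show ?thesis .
  qed
  ultimately show thesis by (rule that)
qed

text \<open>The curve is the Cayley transform \<open>\<gamma> t = (I - t A / 2)\<^sup>-\<^sup>1 (I + t A / 2) X\<close> with \<open>A = K B\<close>, given as
  the solution of a linear equation. Its derivative comes from \<open>solution_has_derivative\<close>, and it
  stays on the manifold because \<open>\<gamma> t - X = t/2 A (\<gamma> t + X)\<close> with \<open>B A\<close> skew.\<close>

lemma tangent_curve:
  fixes X v :: "real^'p^'d"
  assumes X: "X \<in> stiefel B" and v: "v \<in> stiefel_tangent B X"
  shows "\<exists>\<gamma>::real \<Rightarrow> real^'p^'d. \<gamma> 0 = X \<and> (\<forall>t. \<gamma> t \<in> stiefel B) \<and>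
    (\<gamma> has_vector_derivative v) (at 0)"
proof -
  obtain K where K: "transpose K = - K" "K ** (B ** X) = v" by (rule tangent_generator[OF X v])
  define A where "A = K ** B"
  have AX: "A ** X = v" using K(2) by (simp add: A_def mult_assoc)
  define a where "a = (\<lambda>t::real. mat 1 - (t/2) *\<^sub>R A)"
  define r where "r = (\<lambda>t::real. X + (t/2) *\<^sub>R v)"
  have inj: "W = 0" if "a t ** W = 0" for t and W :: "real^'p^'d"
  proof (rule ccontr)
    assume W: "W \<noteq> 0"
    have "W = (t/2) *\<^sub>R (K ** (B ** W))"
      using that by (simp add: a_def A_def matrix_distribs mult_assoc)
    then have "W \<bullet> (B ** W) = (t/2) * ((K ** (B ** W)) \<bullet> (B ** W))"
      by (metis inner_scaleR_left)
    then show False using sym_pos_def_inner[OF B W] skew_inner[OF K(1), of "B ** W"] by simp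
  qed
  have "\<exists>Y. a t ** Y = r t" for t
  proof -
    have lin: "linear ((**) (a t) :: real^'p^'d \<Rightarrow> real^'p^'d)"
      by (rule bounded_linear.linear[OF matrix_mult.bounded_linear_right])
    have "inj ((**) (a t) :: real^'p^'d \<Rightarrow> real^'p^'d)"
      using inj linear_injective_0[OF lin] by blast
    from linear_inj_imp_surj[OF lin this] show ?thesis by (metis surjD)
  qed
  then obtain \<gamma> where \<gamma>: "\<And>t. a t ** \<gamma> t = r t" by metis
  have \<gamma>0: "\<gamma> 0 = X" using \<gamma>[of 0] by (simp add: a_def r_def)
  moreover have "\<gamma> t \<in> stiefel B" for t
  proof -
    define Z where "Z = \<gamma> t + X"
    define Q where "Q = (\<lambda>Y::real^'p^'d. transpose Y ** (B ** Y))"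
    have D: "\<gamma> t - X = (t/2) *\<^sub>R (K ** (B ** Z))"
      using \<gamma>[of t]
      by (simp add: a_def r_def Z_def A_def matrix_distribs mult_assoc AX[symmetric] algebra_simps)
    \<comment> \<open>polarization of the quadratic map \<open>Q\<close> at the sum and the difference of \<open>\<gamma> t\<close> and \<open>X\<close>\<close>
    have "2 *\<^sub>R (Q (\<gamma> t) - Q X) =
        transpose Z ** (B ** (\<gamma> t - X)) + transpose (\<gamma> t - X) ** (B ** Z)"
      by (simp add: Q_def Z_def matrix_distribs scaleR_2)
    also have "\<dots> = 0"
      unfolding D by (simp add: matrix_distribs transposes mult_assoc K(1))
    finally have "Q (\<gamma> t) = Q X" by simp
    then show ?thesis using stiefelD[OF X] by (simp add: Q_def stiefel_def mult_assoc)
  qed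
  moreover have "(\<gamma> has_vector_derivative v) (at 0)"
  proof -
    have a': "(a has_derivative (\<lambda>h. - ((h/2) *\<^sub>R A))) (at 0)"
      unfolding a_def by (auto intro!: derivative_eq_intros)
    have r': "(r has_derivative (\<lambda>h. (h/2) *\<^sub>R v)) (at 0)"
      unfolding r_def by (auto intro!: derivative_eq_intros)
    obtain s' where s': "(\<gamma> has_derivative s') (at 0)"
      "\<And>h. a 0 ** s' h = (h/2) *\<^sub>R v - (- ((h/2) *\<^sub>R A)) ** \<gamma> 0"
      using solution_has_derivative[OF bounded_bilinear_matrix_mult a' r' inj[of 0] open_UNIV UNIV_I \<gamma>]
      by blast
    have "s' h = h *\<^sub>R v" for h
      using s'(2)[of h] by (simp add: a_def \<gamma>0 matrix_distribs AX flip: scaleR_left.add)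
    then have "s' = (\<lambda>h. h *\<^sub>R v)" by (rule ext)
    then show ?thesis using s'(1) by (simp add: has_vector_derivative_def)
  qed
  ultimately show ?thesis by blast
qed

lemma stiefel_projected_submanifold:
  "projected_submanifold (stiefel B :: (real^'p^'d) set) (stiefel_tangent B) (trace_metric M) projection"
proof (rule projected_submanifold.intro)
  fix X v U Z :: "real^'p^'d"
  show "bounded_bilinear (trace_metric M :: real^'p^'d \<Rightarrow> _)"
    by (rule bounded_bilinear_trace_metric)
  show "trace_metric M U Z = trace_metric M Z U" by (rule trace_metric_sym)
  show "0 < trace_metric M U U" if "U \<noteq> 0"
    using sym_pos_def_inner[OF M that] by (simp add: trace_metric_inner)
  show "linear (projection X)" by (rule linear_projection)
  show "smooth_open UNIV (\<lambda>X. projection X U)" by (rule smooth_projection)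
  show "trace_metric M (U - projection X U) Z = 0" if "X \<in> stiefel B" "Z \<in> stiefel_tangent B X"
    using normal_orthogonal[OF multiplier_sym that(2)] by (simp add: projection_def)
qed (auto intro: tangent_curve tangentI_functions projection_tangent)

end

section \<open>The Riemannian Hessian\<close>

theorem mainTheorem2:
  fixes B M :: "real^'d^'d"
    and f fbar :: "real^'p^'d \<Rightarrow> real"
    and X \<eta> :: "real^'p^'d"
  assumes "sym_pos_def B" and "sym_pos_def M"
    and "CARD('p) \<le> CARD('d)"
    and "smooth_sub (stiefel B) f"
    and "smooth_open UNIV fbar"
    and "\<forall>Y\<in>stiefel B. fbar Y = f Y"
    and "X \<in> stiefel B"
    and "\<eta> \<in> stiefel_tangent B X"
  shows "stiefel_hessian B M f X \<eta> =
    stiefel_proj B M X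
      (matrix_inv M ** euclidean_hessian fbar X \<eta> -
       matrix_inv M ** B ** \<eta> **
         (transpose X ** euclidean_gradient fbar X - transpose X ** M ** stiefel_gradient B M f X))"
proof -
  interpret stiefel_geometry B M by unfold_locales (use assms in auto)
  interpret geo: projected_submanifold "stiefel B :: (real^'p^'d) set" "stiefel_tangent B"
      "trace_metric M" projection
    by (rule stiefel_projected_submanifold)
  note X = assms(7) and \<eta> = assms(8)
  have ext: "fbar Y = f Y" if "Y \<in> stiefel B" for Y using assms(6) that by blast
  let ?g = "euclidean_gradient fbar"
  define G where "G = (\<lambda>Y. Mi ** ?g Y)"
  define W where "W = (\<lambda>Y. multiplier Y (G Y))"
  have g: "smooth_open UNIV ?g" by (rule smooth_euclidean_gradient[OF assms(5)])
  have G: "smooth_open UNIV G" unfolding G_def by (intro smooth_mult smooth_open_const g)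
  have W: "smooth_open UNIV W" unfolding W_def by (rule smooth_multiplier[OF G])
  have G_grad: "trace_metric M (G Y) v = frechet_derivative fbar (at Y) v" for Y v
    using euclidean_gradient_eq(2)[OF smooth_open_has_derivative[OF assms(5) UNIV_I]]
    by (simp add: trace_metric_inner G_def inner_mult_left Mi Mi_M)
  define dg where "dg = frechet_derivative ?g (at X)"
  define dW where "dW = frechet_derivative W (at X)"
  have dg: "(?g has_derivative dg) (at X)"
    unfolding dg_def by (rule smooth_open_has_derivative[OF g UNIV_I])
  have dW: "(W has_derivative dW) (at X)"
    unfolding dW_def by (rule smooth_open_has_derivative[OF W UNIV_I])
  have dW_sym: "transpose (dW v) = dW v" for v
  proof -
    have "((\<lambda>Y. transpose (W Y)) has_derivative (\<lambda>v. transpose (dW v))) (at X)"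
      by (rule bounded_linear.has_derivative[OF bounded_linear_transpose dW])
    then have "(W has_derivative (\<lambda>v. transpose (dW v))) (at X)"
      by (simp add: W_def multiplier_sym)
    from fun_cong[OF has_derivative_unique[OF this dW]] show ?thesis .
  qed
  have proj_G: "projection Y (G Y) = Mi ** ?g Y - Mi ** (B ** (Y ** W Y))" for Y
    by (simp add: projection_def G_def W_def)
  note left = bounded_linear.has_derivative[OF matrix_mult.bounded_linear_right]
  have "((\<lambda>Y. projection Y (G Y)) has_derivative
      (\<lambda>v. Mi ** dg v - Mi ** (B ** (X ** dW v + v ** W X)))) (at X)"
    unfolding proj_G
    by (rule has_derivative_diff[OF left[OF dg]
          left[OF left[OF matrix_mult.FDERIV[OF has_derivative_ident dW]]]])
  note deriv = has_derivative_imp_frechet[OF this]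
  have W_eq: "W X = transpose X ** ?g X - transpose X ** M ** stiefel_gradient B M f X"
  proof -
    have "stiefel_gradient B M f X = projection X (G X)"
      unfolding stiefel_gradient_def
      by (rule geo.riemannian_gradient_eq[OF X assms(5) ext G_grad])
    then show ?thesis
      by (simp add: proj_G matrix_distribs mult_assoc M_Mi)
        (simp add: matrix_mul_assoc stiefelD[OF X, unfolded matrix_mul_assoc])
  qed
  \<comment> \<open>the multiplier is symmetric along the whole space, so its derivative contributes a normal vector\<close>
  have normal: "projection X (Mi ** (B ** (X ** dW \<eta>))) = 0"
    by (rule geo.P_unique[OF X])
      (use normal_orthogonal[OF dW_sym] in \<open>auto simp: tangent_iff_assoc matrix_distribs\<close>)
  have proj: "stiefel_proj B M X U = projection X U" for U
    unfolding stiefel_proj_def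
    by (rule the_equality)
      (use geo.P_tangent[OF X] geo.P_orthogonal[OF X] geo.P_unique[OF X, of _ U] in auto)
  have "stiefel_hessian B M f X \<eta> = projection X (Mi ** dg \<eta> - Mi ** (B ** (X ** dW \<eta> + \<eta> ** W X)))"
    unfolding stiefel_hessian_def
    using geo.riemannian_hessian_eq[OF X \<eta> assms(5) ext G G_grad] by (simp add: deriv)
  also have "\<dots> = projection X (Mi ** dg \<eta> - Mi ** (B ** (\<eta> ** W X)) - Mi ** (B ** (X ** dW \<eta>)))"
    by (simp add: matrix_distribs algebra_simps)
  also have "\<dots> = projection X (Mi ** dg \<eta> - Mi ** (B ** (\<eta> ** W X)))"
    by (simp add: linear_diff[OF linear_projection] normal)
  also have "\<dots> = stiefel_proj B M X (Mi ** euclidean_hessian fbar X \<eta> - Mi ** B ** \<eta> ** W X)"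
    by (simp add: proj euclidean_hessian_def dg_def mult_assoc)
  finally show ?thesis by (simp only: W_eq)
qed

end
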